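(* Let $\mathcal C$ be a model of classical differential linear logic as in the context, with coKleisli category $\mathcal C_!$ (a Cartesian closed differential category). For $f:{!A}\multimap B$ define $\rho f:=\lambda^{-1}\chi\,\partial f:{!A}\otimes B^\perp\multimap A^\perp$, and let the reverse differential $Rf\in\mathcal C_!(A\times B^\perp,A^\perp)$ be the composite $$!(A\&B^\perp)\simeq{!A}\otimes{!(B^\perp)}\xrightarrow{1\otimes d}{!A}\otimes B^\perp\xrightarrow{\rho f}A^\perp .$$ Then there is a functor $D:\mathcal C_!\to\mathcal E\mathrm{Lens}(\mathcal C_!)$ sending an object $A$ to the first projection $\pi_1:A\times A^\perp\to A$ and an arrow $f:A\to B$ of $\mathcal C_!$ to $$\big(\,f\,,\ A\times A^\perp\xleftarrow{\langle\pi_1,Rf\rangle}A\times B^\perp\xrightarrow{f\times1}B\times B^\perp\,\big).$$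
   Context: Composition is written diagrammatically: $f;g$ is first $f$ then $g$. **The category $\mathcal C$.** $\mathcal C$ is a (left-additive) category enriched over commutative monoids (operations $0,+$ on homsets) with: a symmetric monoidal closed structure $(\otimes,1)$ with internal homs $[A\multimap B]$, currying $\lambda$ and uncurrying $\lambda^{-1}$ (symmetry isos left implicit); finite biproducts $(\&,\top)$; a monoidal comonad $(!,d:{!}\to\mathrm{id},p:{!}\to{!!})$, with contraction $c:{!}\to{!}\otimes{!}$ and weakening $w:{!}\to{!\top}$ making $!$ a storage modality; Seely isomorphisms $!A\otimes{!B}\simeq{!(A\& B)}$, $1\simeq{!\top}$; a codereliction $\overline d:\mathrm{id}\to{!}$ making $\mathcal C$ a differential storage category; and an involutive functor $(\_)^\perp:\mathcal C^{\mathrm{op}}\to\mathcal C$ making $\mathcal C$ $*$-autonomous, with natural bijection $\chi:\mathcal C(D\otimes E,F)\simeq\mathcal C(D,[F^\perp\multimap E^\perp])$. Arrows of $\mathcal C$ are written $A\multimap B$. The cocontraction $\overline c:{!}\otimes{!}\to{!}$ is the usual one induced by the biproducts, and $\partial:=(\overline d\otimes1);\overline c:\mathrm{id}\otimes{!}\to{!}$ is the deriving transformation; for $f:{!A}\multimap B$, $\partial f:=\partial;f:A\otimes{!A}\multimap B$. (In $\rho f$, $\chi$ is applied with $D={!A}$, $E=A$, $F=B$.) $\mathcal C_!$ is the coKleisli category of $!$, $\mathcal C_!(A,B)=\mathcal C(!A,B)$, with arrows written $A\to B$ and products $A\times B:=A\&B$. **Euclidean lenses.** For a category $\mathcal L$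 with binary products, $\mathcal E\mathrm{Lens}(\mathcal L)$ has as objects the first projections $\pi_1:A\times X\to A$; an arrow from $\pi_1:A\times X\to A$ to $\pi_1:B\times Y\to B$ is an $f:A\to B$ together with a span $A\times X\xleftarrow{F}A\times Y\xrightarrow{f\times1}B\times Y$ such that $F;\pi_1^{A,X}=\pi_1^{A,Y}$. The identity is given by $1_A$ and the identity span. The composite of $(f,F):(A\times X\to A)\to(B\times Y\to B)$ and $(g,G):(B\times Y\to B)\to(C\times Z\to C)$ has first component $f;g$ and span $A\times X\xleftarrow{\langle\pi_1,(f\times1);G;\pi_2\rangle;F}A\times Z\xrightarrow{(f;g)\times1}C\times Z$.
   Formalization: The natural bijection χ is also required to be compatible with the action of duality on arrows and with internal composition (the canonical *-autonomous structure); for an arbitrary natural bijection, such as 2χ where 2 is invertible, D fails to preserve identities. *)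

theory Defs
  imports Main
begin

section \<open>Categories and functors\<close>

text \<open>
  The objects of a category are all elements of a type; the arrows are given by hom-sets, which are
  not required to be disjoint.  Composition is diagrammatic.
\<close>

record ('o, 'm) category =
  hom :: "'o \<Rightarrow> 'o \<Rightarrow> 'm set"
  cmp :: "'m \<Rightarrow> 'm \<Rightarrow> 'm"  (infixl ";;\<index>" 55)
  ident :: "'o \<Rightarrow> 'm"  ("\<one>\<index>")

locale category =
  fixes C :: "('o, 'm, 'z) category_scheme" (structure)
  assumes ident_hom: "\<one> A \<in> hom C A A"
    and cmp_hom: "\<lbrakk>f \<in> hom C A B; g \<in> hom C B D\<rbrakk> \<Longrightarrow> f ;; g \<in> hom C A D"
    and cmp_assoc: "\<lbrakk>f \<in> hom C A B; g \<in> hom C B D; h \<in> hom C D E\<rbrakk>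
      \<Longrightarrow> (f ;; g) ;; h = f ;; (g ;; h)"
    and ident_cmp: "f \<in> hom C A B \<Longrightarrow> \<one> A ;; f = f"
    and cmp_ident: "f \<in> hom C A B \<Longrightarrow> f ;; \<one> B = f"

locale functor_between = source: category C + target: category D
  for C :: "('o, 'm, 'z) category_scheme" and D :: "('p, 'n, 'y) category_scheme" +
  fixes Fo :: "'o \<Rightarrow> 'p" and Fa :: "'m \<Rightarrow> 'n"
  assumes map_hom: "f \<in> hom C A B \<Longrightarrow> Fa f \<in> hom D (Fo A) (Fo B)"
    and map_ident: "Fa (ident C A) = ident D (Fo A)"
    and map_cmp: "\<lbrakk>f \<in> hom C A A'; g \<in> hom C A' A''\<rbrakk>
      \<Longrightarrow> Fa (cmp C f g) = cmp D (Fa f) (Fa g)"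

definition inverse_arrows ::
    "('o, 'm, 'z) category_scheme \<Rightarrow> 'o \<Rightarrow> 'o \<Rightarrow> 'm \<Rightarrow> 'm \<Rightarrow> bool" where
  "inverse_arrows C A B f g \<longleftrightarrow> f \<in> hom C A B \<and> g \<in> hom C B A
     \<and> cmp C f g = ident C A \<and> cmp C g f = ident C B"

text \<open>
  An arrow tagged with its source and target, used where composition must know them (as in the
  coKleisli category, where the same arrow \<open>!A \<rightarrow> B\<close> may occur for several \<open>A\<close>).
\<close>

datatype ('o, 'm) arrow = Arrow (source: 'o) (body: 'm) (target: 'o)


section \<open>Binary products and Euclidean lenses\<close>

record ('o, 'm) cartesian = "('o, 'm) category" +
  prd :: "'o \<Rightarrow> 'o \<Rightarrow> 'o"  (infixr "&&\<index>" 75)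
  pr1 :: "'o \<Rightarrow> 'o \<Rightarrow> 'm"
  pr2 :: "'o \<Rightarrow> 'o \<Rightarrow> 'm"
  tup :: "'m \<Rightarrow> 'm \<Rightarrow> 'm"  ("\<langle>_,/ _\<rangle>\<index>")

locale cartesian = category C for C :: "('o, 'm, 'z) cartesian_scheme" (structure) +
  assumes pr1_hom: "pr1 C A B \<in> hom C (A && B) A"
    and pr2_hom: "pr2 C A B \<in> hom C (A && B) B"
    and tup_hom: "\<lbrakk>f \<in> hom C X A; g \<in> hom C X B\<rbrakk> \<Longrightarrow> \<langle>f, g\<rangle> \<in> hom C X (A && B)"
    and tup_pr1: "\<lbrakk>f \<in> hom C X A; g \<in> hom C X B\<rbrakk> \<Longrightarrow> \<langle>f, g\<rangle> ;; pr1 C A B = f"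
    and tup_pr2: "\<lbrakk>f \<in> hom C X A; g \<in> hom C X B\<rbrakk> \<Longrightarrow> \<langle>f, g\<rangle> ;; pr2 C A B = g"
    and tup_unique: "h \<in> hom C X (A && B) \<Longrightarrow> \<langle>h ;; pr1 C A B, h ;; pr2 C A B\<rangle> = h"

text \<open>\<open>times_id L A X f\<close> is \<open>f \<times> 1 : A \<times> X \<rightarrow> B \<times> X\<close>, for \<open>f : A \<rightarrow> B\<close>.\<close>

definition times_id :: "('o, 'm, 'z) cartesian_scheme \<Rightarrow> 'o \<Rightarrow> 'o \<Rightarrow> 'm \<Rightarrow> 'm" where
  "times_id L A X f = tup L (cmp L (pr1 L A X) f) (cmp L (pr2 L A X) (ident L X))"

text \<open>
  \<open>Lens f F s\<close> is the arrow \<open>f\<close> together with the span whose left leg is \<open>F\<close> and whose right leg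
  is \<open>s\<close>.
\<close>

datatype 'm lens = Lens (base: 'm) (left_leg: 'm) (right_leg: 'm)

text \<open>
  As an object, the pair \<open>(A, X)\<close> stands for the first projection \<open>A \<times> X \<rightarrow> A\<close>.
\<close>

definition ELens ::
    "('o, 'm, 'z) cartesian_scheme \<Rightarrow> ('o \<times> 'o, ('o \<times> 'o, 'm lens) arrow) category" where
  "ELens L =
    \<lparr> hom = \<lambda>(A, X) (B, Y). {Arrow (A, X) (Lens f F (times_id L A Y f)) (B, Y) | f F.
              f \<in> hom L A B \<and> F \<in> hom L (prd L A Y) (prd L A X) \<and>
              cmp L F (pr1 L A X) = pr1 L A Y},
      cmp = \<lambda>u v.
        (let (A, X) = source u; (B, Y) = target u; (C, Z) = target v;
             f = base (body u); F = left_leg (body u);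
             g = base (body v); G = left_leg (body v)
         in Arrow (A, X)
              (Lens (cmp L f g)
                    (cmp L (tup L (pr1 L A Z)
                                  (cmp L (cmp L (times_id L A Z f) G) (pr2 L B Y)))
                           F)
                    (times_id L A Z (cmp L f g)))
              (C, Z)),
      ident = \<lambda>(A, X). Arrow (A, X)
        (Lens (ident L A) (ident L (prd L A X)) (ident L (prd L A X))) (A, X) \<rparr>"


section \<open>Additive categories with finite biproducts\<close>

record ('o, 'm) biproduct_cat = "('o, 'm) cartesian" +
  top :: 'o  ("\<top>\<index>")
  inj1 :: "'o \<Rightarrow> 'o \<Rightarrow> 'm"
  inj2 :: "'o \<Rightarrow> 'o \<Rightarrow> 'm"
  zero_arr :: "'o \<Rightarrow> 'o \<Rightarrow> 'm"  ("\<zero>\<index>")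
  add_arr :: "'m \<Rightarrow> 'm \<Rightarrow> 'm"  (infixl "\<oplus>\<index>" 53)

locale biproduct_cat = cartesian C for C :: "('o, 'm, 'z) biproduct_cat_scheme" (structure) +
  assumes zero_hom: "\<zero> A B \<in> hom C A B"
    and add_hom: "\<lbrakk>f \<in> hom C A B; g \<in> hom C A B\<rbrakk> \<Longrightarrow> f \<oplus> g \<in> hom C A B"
    and add_assoc: "\<lbrakk>f \<in> hom C A B; g \<in> hom C A B; h \<in> hom C A B\<rbrakk>
      \<Longrightarrow> (f \<oplus> g) \<oplus> h = f \<oplus> (g \<oplus> h)"
    and add_commute: "\<lbrakk>f \<in> hom C A B; g \<in> hom C A B\<rbrakk> \<Longrightarrow> f \<oplus> g = g \<oplus> f"
    and add_zero: "f \<in> hom C A B \<Longrightarrow> f \<oplus> \<zero> A B = f"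
    and cmp_add: "\<lbrakk>f \<in> hom C A B; g \<in> hom C B D; h \<in> hom C B D\<rbrakk>
      \<Longrightarrow> f ;; (g \<oplus> h) = f ;; g \<oplus> f ;; h"
    and add_cmp: "\<lbrakk>f \<in> hom C A B; g \<in> hom C A B; h \<in> hom C B D\<rbrakk>
      \<Longrightarrow> (f \<oplus> g) ;; h = f ;; h \<oplus> g ;; h"
    and cmp_zero: "f \<in> hom C A B \<Longrightarrow> f ;; \<zero> B D = \<zero> A D"
    and zero_cmp: "f \<in> hom C B D \<Longrightarrow> \<zero> A B ;; f = \<zero> A D"
    and top_zero_object: "\<one> \<top> = \<zero> \<top> \<top>"
    and inj1_hom: "inj1 C A B \<in> hom C A (A && B)"
    and inj2_hom: "inj2 C A B \<in> hom C B (A && B)"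
    and inj1_pr1: "inj1 C A B ;; pr1 C A B = \<one> A"
    and inj1_pr2: "inj1 C A B ;; pr2 C A B = \<zero> A B"
    and inj2_pr1: "inj2 C A B ;; pr1 C A B = \<zero> B A"
    and inj2_pr2: "inj2 C A B ;; pr2 C A B = \<one> B"
    and pr_inj: "pr1 C A B ;; inj1 C A B \<oplus> pr2 C A B ;; inj2 C A B = \<one> (A && B)"

text \<open>The codiagonal \<open>A & A \<rightarrow> A\<close>.\<close>

definition codiag :: "('o, 'm, 'z) biproduct_cat_scheme \<Rightarrow> 'o \<Rightarrow> 'm" where
  "codiag C A = add_arr C (pr1 C A A) (pr2 C A A)"


section \<open>Symmetric monoidal closed structure\<close>

record ('o, 'm) monoidal_cat = "('o, 'm) biproduct_cat" +
  tensor :: "'o \<Rightarrow> 'o \<Rightarrow> 'o"  (infixr "\<otimes>\<index>" 70)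
  tensor_arr :: "'m \<Rightarrow> 'm \<Rightarrow> 'm"  (infixr "\<otimes>\<^sub>m\<index>" 70)
  tunit :: 'o  ("\<I>\<index>")
  assoc :: "'o \<Rightarrow> 'o \<Rightarrow> 'o \<Rightarrow> 'm"  ("\<a>\<index>")
  assoc_inv :: "'o \<Rightarrow> 'o \<Rightarrow> 'o \<Rightarrow> 'm"  ("\<a>'_inv\<index>")
  lunit :: "'o \<Rightarrow> 'm"  ("\<l>\<index>")
  lunit_inv :: "'o \<Rightarrow> 'm"  ("\<l>'_inv\<index>")
  runit :: "'o \<Rightarrow> 'm"  ("\<r>\<index>")
  runit_inv :: "'o \<Rightarrow> 'm"  ("\<r>'_inv\<index>")
  symm :: "'o \<Rightarrow> 'o \<Rightarrow> 'm"  ("\<s>\<index>")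
  lhom :: "'o \<Rightarrow> 'o \<Rightarrow> 'o"  ("[_ \<multimap>\<index> _]")
  ev :: "'o \<Rightarrow> 'o \<Rightarrow> 'm"
  cur :: "'o \<Rightarrow> 'o \<Rightarrow> 'o \<Rightarrow> 'm \<Rightarrow> 'm"

locale monoidal_cat = biproduct_cat C for C :: "('o, 'm, 'z) monoidal_cat_scheme" (structure) +
  assumes tensor_hom: "\<lbrakk>f \<in> hom C A A'; g \<in> hom C B B'\<rbrakk> \<Longrightarrow> f \<otimes>\<^sub>m g \<in> hom C (A \<otimes> B) (A' \<otimes> B')"
    and tensor_ident: "\<one> A \<otimes>\<^sub>m \<one> B = \<one> (A \<otimes> B)"
    and tensor_cmp: "\<lbrakk>f \<in> hom C A A'; f' \<in> hom C A' A''; g \<in> hom C B B'; g' \<in> hom C B' B''\<rbrakk>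
      \<Longrightarrow> (f ;; f') \<otimes>\<^sub>m (g ;; g') = (f \<otimes>\<^sub>m g) ;; (f' \<otimes>\<^sub>m g')"
    and tensor_add: "\<lbrakk>f \<in> hom C A A'; g \<in> hom C B B'; g' \<in> hom C B B'\<rbrakk>
      \<Longrightarrow> f \<otimes>\<^sub>m (g \<oplus> g') = (f \<otimes>\<^sub>m g) \<oplus> (f \<otimes>\<^sub>m g')"
    and add_tensor: "\<lbrakk>f \<in> hom C A A'; f' \<in> hom C A A'; g \<in> hom C B B'\<rbrakk>
      \<Longrightarrow> (f \<oplus> f') \<otimes>\<^sub>m g = (f \<otimes>\<^sub>m g) \<oplus> (f' \<otimes>\<^sub>m g)"
    and tensor_zero: "f \<in> hom C A A' \<Longrightarrow> f \<otimes>\<^sub>m \<zero> B B' = \<zero> (A \<otimes> B) (A' \<otimes> B')"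
    and zero_tensor: "g \<in> hom C B B' \<Longrightarrow> \<zero> A A' \<otimes>\<^sub>m g = \<zero> (A \<otimes> B) (A' \<otimes> B')"
    and assoc_iso: "inverse_arrows C ((A \<otimes> B) \<otimes> D) (A \<otimes> (B \<otimes> D)) (\<a> A B D) (\<a>_inv A B D)"
    and assoc_nat: "\<lbrakk>f \<in> hom C A A'; g \<in> hom C B B'; h \<in> hom C D D'\<rbrakk>
      \<Longrightarrow> ((f \<otimes>\<^sub>m g) \<otimes>\<^sub>m h) ;; \<a> A' B' D' = \<a> A B D ;; (f \<otimes>\<^sub>m (g \<otimes>\<^sub>m h))"
    and lunit_iso: "inverse_arrows C (\<I> \<otimes> A) A (\<l> A) (\<l>_inv A)"
    and lunit_nat: "f \<in> hom C A B \<Longrightarrow> (\<one> \<I> \<otimes>\<^sub>m f) ;; \<l> B = \<l> A ;; f"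
    and runit_iso: "inverse_arrows C (A \<otimes> \<I>) A (\<r> A) (\<r>_inv A)"
    and runit_nat: "f \<in> hom C A B \<Longrightarrow> (f \<otimes>\<^sub>m \<one> \<I>) ;; \<r> B = \<r> A ;; f"
    and pentagon: "\<a> (A \<otimes> B) D E ;; \<a> A B (D \<otimes> E)
      = (\<a> A B D \<otimes>\<^sub>m \<one> E) ;; \<a> A (B \<otimes> D) E ;; (\<one> A \<otimes>\<^sub>m \<a> B D E)"
    and triangle: "\<a> A \<I> B ;; (\<one> A \<otimes>\<^sub>m \<l> B) = \<r> A \<otimes>\<^sub>m \<one> B"
    and symm_hom: "\<s> A B \<in> hom C (A \<otimes> B) (B \<otimes> A)"
    and symm_nat: "\<lbrakk>f \<in> hom C A A'; g \<in> hom C B B'\<rbrakk>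
      \<Longrightarrow> (f \<otimes>\<^sub>m g) ;; \<s> A' B' = \<s> A B ;; (g \<otimes>\<^sub>m f)"
    and symm_symm: "\<s> A B ;; \<s> B A = \<one> (A \<otimes> B)"
    and symm_unit: "\<s> A \<I> ;; \<l> A = \<r> A"
    and hexagon: "\<a> A B D ;; \<s> A (B \<otimes> D) ;; \<a> B D A
      = (\<s> A B \<otimes>\<^sub>m \<one> D) ;; \<a> B A D ;; (\<one> B \<otimes>\<^sub>m \<s> A D)"
    and ev_hom: "ev C A B \<in> hom C ([A \<multimap> B] \<otimes> A) B"
    and cur_hom: "f \<in> hom C (D \<otimes> A) B \<Longrightarrow> cur C D A B f \<in> hom C D [A \<multimap> B]"
    and cur_ev: "f \<in> hom C (D \<otimes> A) B \<Longrightarrow> (cur C D A B f \<otimes>\<^sub>m \<one> A) ;; ev C A B = f"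
    and cur_unique: "g \<in> hom C D [A \<multimap> B] \<Longrightarrow> cur C D A B ((g \<otimes>\<^sub>m \<one> A) ;; ev C A B) = g"

context
  fixes C :: "('o, 'm, 'z) monoidal_cat_scheme" (structure)
begin

definition uncur :: "'o \<Rightarrow> 'o \<Rightarrow> 'm \<Rightarrow> 'm" where
  "uncur A B g = (g \<otimes>\<^sub>m \<one> A) ;; ev C A B"

text \<open>
  \<open>lhom_arr A A' B B' u v : [A \<multimap> B] \<rightarrow> [A' \<multimap> B']\<close> for \<open>u : A' \<rightarrow> A\<close> and \<open>v : B \<rightarrow> B'\<close>.
\<close>

definition lhom_arr :: "'o \<Rightarrow> 'o \<Rightarrow> 'o \<Rightarrow> 'o \<Rightarrow> 'm \<Rightarrow> 'm \<Rightarrow> 'm" where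
  "lhom_arr A A' B B' u v = cur C [A \<multimap> B] A' B' ((\<one> [A \<multimap> B] \<otimes>\<^sub>m u) ;; ev C A B ;; v)"

text \<open>The middle exchange \<open>(A \<otimes> B) \<otimes> (D \<otimes> E) \<rightarrow> (A \<otimes> D) \<otimes> (B \<otimes> E)\<close>.\<close>

definition exch :: "'o \<Rightarrow> 'o \<Rightarrow> 'o \<Rightarrow> 'o \<Rightarrow> 'm" where
  "exch A B D E = \<a> A B (D \<otimes> E)
     ;; (\<one> A \<otimes>\<^sub>m (\<a>_inv B D E ;; (\<s> B D \<otimes>\<^sub>m \<one> E) ;; \<a> D B E))
     ;; \<a>_inv A D (B \<otimes> E)"

end


section \<open>Storage modalities\<close>

text \<open>
  The weakening has target \<open>!\<top>\<close>; the counit \<open>!A \<rightarrow> \<I>\<close> of the comonoid \<open>!A\<close> is obtained from it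
  through the nullary Seely isomorphism \<open>\<I> \<simeq> !\<top>\<close>.
\<close>

record ('o, 'm) storage_cat = "('o, 'm) monoidal_cat" +
  bang :: "'o \<Rightarrow> 'o"  ("\<^bold>!\<index>")
  bang_arr :: "'m \<Rightarrow> 'm"  ("\<^bold>!\<^sub>m\<index>")
  der :: "'o \<Rightarrow> 'm"
  dig :: "'o \<Rightarrow> 'm"
  mon0 :: 'm
  mon2 :: "'o \<Rightarrow> 'o \<Rightarrow> 'm"
  contr :: "'o \<Rightarrow> 'm"
  weak :: "'o \<Rightarrow> 'm"
  seely0 :: 'm
  seely0_inv :: 'm
  seely :: "'o \<Rightarrow> 'o \<Rightarrow> 'm"

context
  fixes C :: "('o, 'm, 'z) storage_cat_scheme" (structure)
begin

definition counit :: "'o \<Rightarrow> 'm" where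
  "counit A = weak C A ;; seely0_inv C"

definition seely_inv :: "'o \<Rightarrow> 'o \<Rightarrow> 'm" where
  "seely_inv A B = contr C (A && B) ;; (\<^bold>!\<^sub>m (pr1 C A B) \<otimes>\<^sub>m \<^bold>!\<^sub>m (pr2 C A B))"

text \<open>The bialgebra structure induced by the biproducts.\<close>

definition cocontr :: "'o \<Rightarrow> 'm" where
  "cocontr A = seely C A A ;; \<^bold>!\<^sub>m (codiag C A)"

definition coweak :: "'o \<Rightarrow> 'm" where
  "coweak A = seely0 C ;; \<^bold>!\<^sub>m (\<zero> \<top> A)"

end

text \<open>
  A storage modality: a symmetric monoidal comonad with a natural cocommutative comonoid structure
  on each \<open>!A\<close>, given by monoidal transformations that are morphisms of \<open>!\<close>-coalgebras and
  preserved by \<open>p\<close>, whose canonical Seely maps are isomorphisms.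
\<close>

locale storage_cat = monoidal_cat C for C :: "('o, 'm, 'z) storage_cat_scheme" (structure) +
  assumes bang_hom: "f \<in> hom C A B \<Longrightarrow> \<^bold>!\<^sub>m f \<in> hom C (\<^bold>! A) (\<^bold>! B)"
    and bang_ident: "\<^bold>!\<^sub>m (\<one> A) = \<one> (\<^bold>! A)"
    and bang_cmp: "\<lbrakk>f \<in> hom C A B; g \<in> hom C B D\<rbrakk> \<Longrightarrow> \<^bold>!\<^sub>m (f ;; g) = \<^bold>!\<^sub>m f ;; \<^bold>!\<^sub>m g"
  \<comment> \<open>comonad\<close>
    and der_hom: "der C A \<in> hom C (\<^bold>! A) A"
    and der_nat: "f \<in> hom C A B \<Longrightarrow> \<^bold>!\<^sub>m f ;; der C B = der C A ;; f"
    and dig_hom: "dig C A \<in> hom C (\<^bold>! A) (\<^bold>! (\<^bold>! A))"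
    and dig_nat: "f \<in> hom C A B \<Longrightarrow> \<^bold>!\<^sub>m f ;; dig C B = dig C A ;; \<^bold>!\<^sub>m (\<^bold>!\<^sub>m f)"
    and dig_der: "dig C A ;; der C (\<^bold>! A) = \<one> (\<^bold>! A)"
    and dig_bang_der: "dig C A ;; \<^bold>!\<^sub>m (der C A) = \<one> (\<^bold>! A)"
    and dig_dig: "dig C A ;; dig C (\<^bold>! A) = dig C A ;; \<^bold>!\<^sub>m (dig C A)"
  \<comment> \<open>symmetric monoidal structure of the comonad\<close>
    and mon0_hom: "mon0 C \<in> hom C \<I> (\<^bold>! \<I>)"
    and mon2_hom: "mon2 C A B \<in> hom C (\<^bold>! A \<otimes> \<^bold>! B) (\<^bold>! (A \<otimes> B))"
    and mon2_nat: "\<lbrakk>f \<in> hom C A A'; g \<in> hom C B B'\<rbrakk>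
      \<Longrightarrow> (\<^bold>!\<^sub>m f \<otimes>\<^sub>m \<^bold>!\<^sub>m g) ;; mon2 C A' B' = mon2 C A B ;; \<^bold>!\<^sub>m (f \<otimes>\<^sub>m g)"
    and mon_assoc: "(mon2 C A B \<otimes>\<^sub>m \<one> (\<^bold>! D)) ;; mon2 C (A \<otimes> B) D ;; \<^bold>!\<^sub>m (\<a> A B D)
      = \<a> (\<^bold>! A) (\<^bold>! B) (\<^bold>! D) ;; (\<one> (\<^bold>! A) \<otimes>\<^sub>m mon2 C B D) ;; mon2 C A (B \<otimes> D)"
    and mon_lunit: "(mon0 C \<otimes>\<^sub>m \<one> (\<^bold>! A)) ;; mon2 C \<I> A ;; \<^bold>!\<^sub>m (\<l> A) = \<l> (\<^bold>! A)"
    and mon_runit: "(\<one> (\<^bold>! A) \<otimes>\<^sub>m mon0 C) ;; mon2 C A \<I> ;; \<^bold>!\<^sub>m (\<r> A) = \<r> (\<^bold>! A)"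
    and mon_symm: "mon2 C A B ;; \<^bold>!\<^sub>m (\<s> A B) = \<s> (\<^bold>! A) (\<^bold>! B) ;; mon2 C B A"
    and der_mon2: "mon2 C A B ;; der C (A \<otimes> B) = der C A \<otimes>\<^sub>m der C B"
    and der_mon0: "mon0 C ;; der C \<I> = \<one> \<I>"
    and dig_mon2: "mon2 C A B ;; dig C (A \<otimes> B)
      = (dig C A \<otimes>\<^sub>m dig C B) ;; mon2 C (\<^bold>! A) (\<^bold>! B) ;; \<^bold>!\<^sub>m (mon2 C A B)"
    and dig_mon0: "mon0 C ;; dig C \<I> = mon0 C ;; \<^bold>!\<^sub>m (mon0 C)"
  \<comment> \<open>natural cocommutative comonoids\<close>
    and seely0_iso: "inverse_arrows C \<I> (\<^bold>! \<top>) (seely0 C) (seely0_inv C)"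
    and contr_hom: "contr C A \<in> hom C (\<^bold>! A) (\<^bold>! A \<otimes> \<^bold>! A)"
    and contr_nat: "f \<in> hom C A B \<Longrightarrow> \<^bold>!\<^sub>m f ;; contr C B = contr C A ;; (\<^bold>!\<^sub>m f \<otimes>\<^sub>m \<^bold>!\<^sub>m f)"
    and weak_hom: "weak C A \<in> hom C (\<^bold>! A) (\<^bold>! \<top>)"
    and weak_nat: "f \<in> hom C A B \<Longrightarrow> \<^bold>!\<^sub>m f ;; weak C B = weak C A"
    and contr_assoc: "contr C A ;; (contr C A \<otimes>\<^sub>m \<one> (\<^bold>! A)) ;; \<a> (\<^bold>! A) (\<^bold>! A) (\<^bold>! A)
      = contr C A ;; (\<one> (\<^bold>! A) \<otimes>\<^sub>m contr C A)"
    and contr_counit: "contr C A ;; (counit C A \<otimes>\<^sub>m \<one> (\<^bold>! A)) ;; \<l> (\<^bold>! A) = \<one> (\<^bold>! A)"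
    and contr_symm: "contr C A ;; \<s> (\<^bold>! A) (\<^bold>! A) = contr C A"
    and dig_contr: "dig C A ;; contr C (\<^bold>! A) = contr C A ;; (dig C A \<otimes>\<^sub>m dig C A)"
    and dig_counit: "dig C A ;; counit C (\<^bold>! A) = counit C A"
  \<comment> \<open>contraction and counit are monoidal\<close>
    and contr_mon2: "mon2 C A B ;; contr C (A \<otimes> B)
      = (contr C A \<otimes>\<^sub>m contr C B) ;; exch C (\<^bold>! A) (\<^bold>! A) (\<^bold>! B) (\<^bold>! B)
        ;; (mon2 C A B \<otimes>\<^sub>m mon2 C A B)"
    and contr_mon0: "mon0 C ;; contr C \<I> = \<l>_inv \<I> ;; (mon0 C \<otimes>\<^sub>m mon0 C)"
    and counit_mon2: "mon2 C A B ;; counit C (A \<otimes> B) = (counit C A \<otimes>\<^sub>m counit C B) ;; \<l> \<I>"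
    and counit_mon0: "mon0 C ;; counit C \<I> = \<one> \<I>"
  \<comment> \<open>contraction and counit are morphisms of \<open>!\<close>-coalgebras\<close>
    and contr_coalg: "dig C A ;; \<^bold>!\<^sub>m (contr C A)
      = contr C A ;; (dig C A \<otimes>\<^sub>m dig C A) ;; mon2 C (\<^bold>! A) (\<^bold>! A)"
    and counit_coalg: "dig C A ;; \<^bold>!\<^sub>m (counit C A) = counit C A ;; mon0 C"
  \<comment> \<open>Seely isomorphisms\<close>
    and counit_top: "counit C \<top> = seely0_inv C"
    and seely_iso: "inverse_arrows C (\<^bold>! A \<otimes> \<^bold>! B) (\<^bold>! (A && B)) (seely C A B) (seely_inv C A B)"


section \<open>Codereliction and duality\<close>

record ('o, 'm) dill = "('o, 'm) storage_cat" +
  codr :: "'o \<Rightarrow> 'm"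
  dual :: "'o \<Rightarrow> 'o"  ("_\<^sup>\<bottom>\<index>" [1000] 999)
  dual_arr :: "'m \<Rightarrow> 'm"
  bidual :: "'o \<Rightarrow> 'm"
  bidual_inv :: "'o \<Rightarrow> 'm"
  chi :: "'o \<Rightarrow> 'o \<Rightarrow> 'o \<Rightarrow> 'm \<Rightarrow> 'm"

context
  fixes C :: "('o, 'm, 'z) dill_scheme" (structure)
begin

text \<open>The deriving transformation \<open>\<partial> : A \<otimes> !A \<rightarrow> !A\<close>.\<close>

definition deriv :: "'o \<Rightarrow> 'm" where
  "deriv A = (codr C A \<otimes>\<^sub>m \<one> (\<^bold>! A)) ;; cocontr C A"

text \<open>For \<open>h : D \<otimes> E \<rightarrow> F\<close>, the arrow \<open>\<lambda>\<^sup>-\<^sup>1 (\<chi> h) : D \<otimes> F\<^sup>\<bottom> \<rightarrow> E\<^sup>\<bottom>\<close>.\<close>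

definition transp :: "'o \<Rightarrow> 'o \<Rightarrow> 'o \<Rightarrow> 'm \<Rightarrow> 'm" where
  "transp D E F h = uncur C (F\<^sup>\<bottom>) (E\<^sup>\<bottom>) (chi C D E F h)"

end

text \<open>
  In a \<open>*\<close>-autonomous category \<open>\<chi>\<close> is not an arbitrary natural family of bijections: it exhibits
  duality as an enriched (closed) functor from the opposite category, i.e. the induced arrows
  \<open>[E \<multimap> F] \<rightarrow> [F\<^sup>\<bottom> \<multimap> E\<^sup>\<bottom>]\<close> internalise the action of duality on arrows and are compatible with
  internal composition.  These are \<open>chi_arr\<close> and \<open>chi_cmp\<close>, written after uncurrying.  Without them
  \<open>\<chi>\<close> could be rescaled by an invertible scalar.  Duality is involutive up to natural isomorphism;
  strict involutions are the case where \<open>bidual\<close> is the identity.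
\<close>

locale classical_dill = storage_cat C for C :: "('o, 'm, 'z) dill_scheme" (structure) +
  assumes codr_hom: "codr C A \<in> hom C A (\<^bold>! A)"
    and codr_nat: "f \<in> hom C A B \<Longrightarrow> codr C A ;; \<^bold>!\<^sub>m f = f ;; codr C B"
    and codr_const: "codr C A ;; counit C A = \<zero> A \<I>"
    and codr_product: "codr C A ;; contr C A
      = \<r>_inv A ;; (codr C A \<otimes>\<^sub>m coweak C A) \<oplus> \<l>_inv A ;; (coweak C A \<otimes>\<^sub>m codr C A)"
    and codr_linear: "codr C A ;; der C A = \<one> A"
    and codr_chain: "deriv C A ;; dig C A
      = (\<one> A \<otimes>\<^sub>m contr C A) ;; \<a>_inv A (\<^bold>! A) (\<^bold>! A) ;; (deriv C A \<otimes>\<^sub>m dig C A) ;; deriv C (\<^bold>! A)"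
  \<comment> \<open>involutive contravariant functor\<close>
    and dual_hom: "f \<in> hom C A B \<Longrightarrow> dual_arr C f \<in> hom C (B\<^sup>\<bottom>) (A\<^sup>\<bottom>)"
    and dual_ident: "dual_arr C (\<one> A) = \<one> (A\<^sup>\<bottom>)"
    and dual_cmp: "\<lbrakk>f \<in> hom C A B; g \<in> hom C B D\<rbrakk>
      \<Longrightarrow> dual_arr C (f ;; g) = dual_arr C g ;; dual_arr C f"
    and bidual_iso: "inverse_arrows C A ((A\<^sup>\<bottom>)\<^sup>\<bottom>) (bidual C A) (bidual_inv C A)"
    and bidual_nat: "f \<in> hom C A B
      \<Longrightarrow> f ;; bidual C B = bidual C A ;; dual_arr C (dual_arr C f)"
  \<comment> \<open>the natural bijection \<open>\<chi>\<close>\<close>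
    and chi_bij: "bij_betw (chi C D E F) (hom C (D \<otimes> E) F) (hom C D [F\<^sup>\<bottom> \<multimap> E\<^sup>\<bottom>])"
    and chi_nat1: "\<lbrakk>h \<in> hom C (D \<otimes> E) F; u \<in> hom C D' D\<rbrakk>
      \<Longrightarrow> chi C D' E F ((u \<otimes>\<^sub>m \<one> E) ;; h) = u ;; chi C D E F h"
    and chi_nat2: "\<lbrakk>h \<in> hom C (D \<otimes> E) F; v \<in> hom C E' E\<rbrakk>
      \<Longrightarrow> chi C D E' F ((\<one> D \<otimes>\<^sub>m v) ;; h)
        = chi C D E F h
          ;; lhom_arr C (F\<^sup>\<bottom>) (F\<^sup>\<bottom>) (E\<^sup>\<bottom>) (E'\<^sup>\<bottom>) (\<one> (F\<^sup>\<bottom>)) (dual_arr C v)"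
    and chi_nat3: "\<lbrakk>h \<in> hom C (D \<otimes> E) F; w \<in> hom C F F'\<rbrakk>
      \<Longrightarrow> chi C D E F' (h ;; w)
        = chi C D E F h
          ;; lhom_arr C (F\<^sup>\<bottom>) (F'\<^sup>\<bottom>) (E\<^sup>\<bottom>) (E\<^sup>\<bottom>) (dual_arr C w) (\<one> (E\<^sup>\<bottom>))"
    and chi_arr: "f \<in> hom C E F \<Longrightarrow> transp C \<I> E F (\<l> E ;; f) = \<l> (F\<^sup>\<bottom>) ;; dual_arr C f"
    and chi_cmp: "\<lbrakk>h \<in> hom C (D \<otimes> E) F; k \<in> hom C (D' \<otimes> F) G\<rbrakk>
      \<Longrightarrow> transp C (D' \<otimes> D) E G (\<a> D' D E ;; (\<one> D' \<otimes>\<^sub>m h) ;; k)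
        = (\<s> D' D \<otimes>\<^sub>m \<one> (G\<^sup>\<bottom>)) ;; \<a> D D' (G\<^sup>\<bottom>)
          ;; (\<one> D \<otimes>\<^sub>m transp C D' F G k) ;; transp C D E F h"


section \<open>The coKleisli category and the reverse differential\<close>

definition coKleisli ::
    "('o, 'm, 'z) dill_scheme \<Rightarrow> ('o, ('o, 'm) arrow) cartesian" where
  "coKleisli C =
    \<lparr> hom = \<lambda>A B. {Arrow A f B | f. f \<in> hom C (bang C A) B},
      cmp = \<lambda>u v. Arrow (source u)
        (cmp C (cmp C (dig C (source u)) (bang_arr C (body u))) (body v)) (target v),
      ident = \<lambda>A. Arrow A (der C A) A,
      prd = prd C,
      pr1 = \<lambda>A B. Arrow (prd C A B) (cmp C (der C (prd C A B)) (pr1 C A B)) A,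
      pr2 = \<lambda>A B. Arrow (prd C A B) (cmp C (der C (prd C A B)) (pr2 C A B)) B,
      tup = \<lambda>u v. Arrow (source u) (tup C (body u) (body v)) (prd C (target u) (target v)) \<rparr>"

context
  fixes C :: "('o, 'm, 'z) dill_scheme" (structure)
begin

text \<open>\<open>\<partial>f : A \<otimes> !A \<rightarrow> B\<close> and \<open>\<rho>f : !A \<otimes> B\<^sup>\<bottom> \<rightarrow> A\<^sup>\<bottom>\<close>, for \<open>f : !A \<rightarrow> B\<close>.\<close>

definition deriv_of :: "'o \<Rightarrow> 'm \<Rightarrow> 'm" where
  "deriv_of A f = deriv C A ;; f"

definition rho :: "'o \<Rightarrow> 'o \<Rightarrow> 'm \<Rightarrow> 'm" where
  "rho A B f = transp C (\<^bold>! A) A B (\<s> (\<^bold>! A) A ;; deriv_of A f)"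

text \<open>The arrow \<open>Rf : A \<times> B\<^sup>\<bottom> \<rightarrow> A\<^sup>\<bottom>\<close> of the coKleisli category, for \<open>f : A \<rightarrow> B\<close> in it.\<close>

definition rev_diff :: "('o, 'm) arrow \<Rightarrow> ('o, 'm) arrow" where
  "rev_diff f = (let A = source f; B = target f in
     Arrow (A && B\<^sup>\<bottom>)
       (seely_inv C A (B\<^sup>\<bottom>) ;; (\<one> (\<^bold>! A) \<otimes>\<^sub>m der C (B\<^sup>\<bottom>)) ;; rho A B (body f))
       (A\<^sup>\<bottom>))"

end

end

theory Submission
  imports Defs
begin

text \<open>
  A lens \<open>\<langle>\<pi>\<^sub>1, Rf\<rangle>\<close> carries a point \<open>a\<close> with a covector on the target of \<open>f\<close> to \<open>a\<close> with a covector on its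
  source.  Composition of such lenses is the reverse chain rule
  \<open>R(f;g) = \<langle>\<pi>\<^sub>1, (f \<times> 1);Rg\<rangle>;Rf\<close>, and their identity is \<open>R(1) = \<pi>\<^sub>2\<close>.  So functoriality is the conjunction
  of these two equations (\<open>rev_diff_cmp\<close>, \<open>rev_diff_ident\<close>); that lenses over a Cartesian category
  form a category, and that the coKleisli category is Cartesian, are general facts
  (\<open>category_ELens\<close>, \<open>cartesian_coKleisli\<close>).

  Both equations are first proved in \<open>C\<close> itself, for the arrow \<open>\<rho>f : !A \<otimes> B\<^sup>\<bottom> \<rightarrow> A\<^sup>\<bottom>\<close>.  For the identity,
  the derivative of dereliction projects to the direction, by the Leibniz rule
  (\<open>cocontr_der\<close>) and because codereliction is a section of dereliction without constant part
  (\<open>deriv_der\<close>); its transpose is the projection to the covector (\<open>rho_der\<close>).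

  For a composite, the axiom relating codereliction and \<open>p\<close> is the chain rule for \<open>\<partial>\<close> (\<open>deriv_coKleisli_cmp\<close>), and compatibility of \<open>\<chi>\<close> with internal
  composition turns it into a chain rule for \<open>\<rho>\<close> in the opposite order (\<open>rho_cmp\<close>).  The base point is
  used twice, at \<open>f\<close> and at \<open>g\<close>, and the symmetries needed to bring its two copies to the right
  places are absorbed by cocommutativity.

  To pass from \<open>\<rho>\<close> to \<open>R\<close>, the Seely map is computed on pairings: the inverse Seely map is a contraction
  followed by the two projections, so an arrow \<open>!A \<otimes> B \<rightarrow> E\<close> applied to a coKleisli pair
  \<open>\<langle>u, v\<rangle>\<close> contracts the context and gives one copy to each of \<open>p;!u\<close> and \<open>v\<close>
  (\<open>coKleisli_tup_seely_inv\<close>).  Then the two sides of the reverse chain rule differ only by where the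
  contraction is made, which is coassociativity (\<open>contr_reassoc\<close>).
\<close>

section \<open>Euclidean lenses over a Cartesian category\<close>

lemma (in category) cmp_assoc_left:
  assumes "f \<in> hom C A B" "g \<in> hom C B D" "h \<in> hom C D E" "k \<in> hom C E F"
  shows "f ;; g ;; h ;; k = f ;; (g ;; h ;; k)"
proof -
  have "f ;; g ;; h = f ;; (g ;; h)" by (rule cmp_assoc) (rule assms)+
  moreover have "f ;; (g ;; h) ;; k = f ;; (g ;; h ;; k)"
    by (rule cmp_assoc) (rule cmp_hom assms)+
  ultimately show ?thesis by simp
qed

context cartesian
begin

lemma tup_cmp:
  assumes "h \<in> hom C Y X" "f \<in> hom C X A" "g \<in> hom C X B"
  shows "h ;; \<langle>f, g\<rangle> = \<langle>h ;; f, h ;; g\<rangle>"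
  using tup_unique[OF cmp_hom[OF assms(1) tup_hom[OF assms(2,3)]]]
    cmp_assoc[OF assms(1) tup_hom[OF assms(2,3)] pr1_hom]
    cmp_assoc[OF assms(1) tup_hom[OF assms(2,3)] pr2_hom]
    tup_pr1[OF assms(2,3)] tup_pr2[OF assms(2,3)] by simp

lemma tup_pr1_pr2: "\<langle>pr1 C A B, pr2 C A B\<rangle> = \<one> (A && B)"
  using tup_unique[OF ident_hom] by (simp add: ident_cmp[OF pr1_hom] ident_cmp[OF pr2_hom])

lemma times_id_eq: "times_id C A X f = \<langle>pr1 C A X ;; f, pr2 C A X\<rangle>"
  by (simp add: times_id_def cmp_ident[OF pr2_hom])

lemma times_id_hom: "f \<in> hom C A B \<Longrightarrow> times_id C A X f \<in> hom C (A && X) (B && X)"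
  unfolding times_id_eq by (rule tup_hom cmp_hom pr1_hom pr2_hom | assumption)+

lemma times_id_ident: "times_id C A X (\<one> A) = \<one> (A && X)"
  by (simp add: times_id_eq cmp_ident[OF pr1_hom] tup_pr1_pr2)

lemma tup_times_id:
  assumes "h \<in> hom C W A" "k \<in> hom C W X" "f \<in> hom C A B"
  shows "\<langle>h, k\<rangle> ;; times_id C A X f = \<langle>h ;; f, k\<rangle>"
proof -
  have "\<langle>h, k\<rangle> ;; times_id C A X f = \<langle>\<langle>h, k\<rangle> ;; (pr1 C A X ;; f), \<langle>h, k\<rangle> ;; pr2 C A X\<rangle>"
    unfolding times_id_eq
    by (rule tup_cmp) (rule tup_hom cmp_hom pr1_hom pr2_hom assms)+
  also have "\<dots> = \<langle>h ;; f, k\<rangle>"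
    using cmp_assoc[OF tup_hom[OF assms(1,2)] pr1_hom assms(3)] tup_pr1[OF assms(1,2)]
      tup_pr2[OF assms(1,2)] by simp
  finally show ?thesis .
qed

text \<open>The left leg of a composite lens is \<open>pull A B Y Z f G ;; F\<close>: the arrow \<open>G\<close> over \<open>B\<close> is pulled
  back along \<open>f\<close> to an arrow \<open>A \<times> Z \<rightarrow> A \<times> Y\<close> over \<open>A\<close>.\<close>

definition pull :: "'o \<Rightarrow> 'o \<Rightarrow> 'o \<Rightarrow> 'o \<Rightarrow> 'm \<Rightarrow> 'm \<Rightarrow> 'm" where
  "pull A B Y Z f G = \<langle>pr1 C A Z, times_id C A Z f ;; G ;; pr2 C B Y\<rangle>"

lemma pull_hom:
  assumes "f \<in> hom C A B" "G \<in> hom C (B && Z) (B && Y)"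
  shows "pull A B Y Z f G \<in> hom C (A && Z) (A && Y)"
  unfolding pull_def by (rule tup_hom cmp_hom pr1_hom pr2_hom times_id_hom assms)+

lemma pull_pr1:
  assumes "f \<in> hom C A B" "G \<in> hom C (B && Z) (B && Y)"
  shows "pull A B Y Z f G ;; pr1 C A Y = pr1 C A Z"
  unfolding pull_def by (rule tup_pr1) (rule cmp_hom pr1_hom pr2_hom times_id_hom assms)+

text \<open>Since \<open>G\<close> is an arrow over \<open>B\<close>, it is determined by its second component, which is all that
  \<^const>\<open>pull\<close> uses of it.\<close>

lemma pull_times_id:
  assumes "f \<in> hom C A B" "G \<in> hom C (B && Z) (B && Y)" "G ;; pr1 C B Y = pr1 C B Z"
  shows "pull A B Y Z f G ;; times_id C A Y f = times_id C A Z f ;; G"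
proof -
  note ty = tup_hom cmp_hom pr1_hom pr2_hom times_id_hom assms(1,2)
  have "pull A B Y Z f G ;; times_id C A Y f
      = \<langle>pr1 C A Z ;; f, times_id C A Z f ;; G ;; pr2 C B Y\<rangle>"
    unfolding pull_def by (rule tup_times_id) (rule ty)+
  also have "pr1 C A Z ;; f = times_id C A Z f ;; pr1 C B Z"
    unfolding times_id_eq by (rule tup_pr1[symmetric]) (rule ty)+
  also have "\<dots> = times_id C A Z f ;; G ;; pr1 C B Y"
    unfolding assms(3)[symmetric] by (rule cmp_assoc[symmetric]) (rule ty)+
  also have "\<langle>\<dots>, times_id C A Z f ;; G ;; pr2 C B Y\<rangle> = times_id C A Z f ;; G"
    by (rule tup_unique) (rule ty)+
  finally show ?thesis .
qed

lemma ELens_hom_iff: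
  "u \<in> hom (ELens C) (A, X) (B, Y) \<longleftrightarrow> (\<exists>f F. u = Arrow (A, X) (Lens f F (times_id C A Y f)) (B, Y)
     \<and> f \<in> hom C A B \<and> F \<in> hom C (A && Y) (A && X) \<and> F ;; pr1 C A X = pr1 C A Y)"
  by (auto simp: ELens_def)

lemma ELens_ident:
  "\<one>\<^bsub>ELens C\<^esub> (A, X) = Arrow (A, X) (Lens (\<one> A) (\<one> (A && X)) (\<one> (A && X))) (A, X)"
  by (simp add: ELens_def)

lemma ELens_cmp:
  "Arrow (A, X) (Lens f F s) (B, Y) ;;\<^bsub>ELens C\<^esub> Arrow b (Lens g G t) (D, Z)
     = Arrow (A, X) (Lens (f ;; g) (pull A B Y Z f G ;; F) (times_id C A Z (f ;; g))) (D, Z)"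
  by (simp add: ELens_def pull_def)

lemma pull_ident_base:
  assumes "f \<in> hom C (A && Y) (A && X)" "f ;; pr1 C A X = pr1 C A Y"
  shows "pull A A X Y (\<one> A) f = f"
  using assms tup_unique[OF assms(1)] by (simp add: pull_def times_id_ident ident_cmp)

lemma pull_ident:
  assumes "f \<in> hom C A B"
  shows "pull A B Y Y f (\<one> (B && Y)) = \<one> (A && Y)"
proof -
  have "times_id C A Y f ;; pr2 C B Y = pr2 C A Y"
    unfolding times_id_eq by (rule tup_pr2) (rule cmp_hom pr1_hom pr2_hom assms)+
  then show ?thesis
    by (simp add: pull_def cmp_ident[OF times_id_hom[OF assms]] tup_pr1_pr2)
qed

lemma pull_cmp_base:
  assumes f: "f \<in> hom C A B" and g: "g \<in> hom C B D" and H: "H \<in> hom C (D && W) (D && Z)"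
  shows "pull A D Z W (f ;; g) H = pull A B Z W f (pull B D Z W g H)"
proof -
  note ty = tup_hom cmp_hom pr1_hom pr2_hom times_id_hom pull_hom f g H
  have "times_id C A W f ;; times_id C B W g = times_id C A W (f ;; g)"
  proof -
    have "times_id C A W f ;; times_id C B W g = \<langle>pr1 C A W ;; f ;; g, pr2 C A W\<rangle>"
      unfolding times_id_eq[of A] by (rule tup_times_id) (rule ty)+
    also have "pr1 C A W ;; f ;; g = pr1 C A W ;; (f ;; g)"
      by (rule cmp_assoc) (rule ty)+
    finally show ?thesis unfolding times_id_eq .
  qed
  then have "times_id C A W (f ;; g) ;; H ;; pr2 C D Z
      = times_id C A W f ;; times_id C B W g ;; H ;; pr2 C D Z"
    by simp
  also have "\<dots> = times_id C A W f ;; (times_id C B W g ;; H ;; pr2 C D Z)"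
    by (rule cmp_assoc_left) (rule ty)+
  also have "times_id C B W g ;; H ;; pr2 C D Z = pull B D Z W g H ;; pr2 C B Z"
    unfolding pull_def by (rule tup_pr2[symmetric]) (rule ty)+
  also have "times_id C A W f ;; (pull B D Z W g H ;; pr2 C B Z)
      = times_id C A W f ;; pull B D Z W g H ;; pr2 C B Z"
    by (rule cmp_assoc[symmetric]) (rule ty)+
  finally show ?thesis unfolding pull_def[of A] by simp
qed

text \<open>Associativity of lens composition, with the common factor \<open>F\<close> of the left legs removed.\<close>

lemma pull_pull:
  assumes f: "f \<in> hom C A B" and g: "g \<in> hom C B D"
    and G: "G \<in> hom C (B && Z) (B && Y)"
    and H: "H \<in> hom C (D && W) (D && Z)" "H ;; pr1 C D Z = pr1 C D W"
  shows "pull A D Z W (f ;; g) H ;; pull A B Y Z f G = pull A B Y W f (pull B D Z W g H ;; G)"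
proof -
  note ty = tup_hom cmp_hom pr1_hom pr2_hom times_id_hom pull_hom f g G H(1)
  let ?Q = "pull B D Z W g H"
  let ?P = "pull A B Z W f ?Q"
  have Q: "?Q \<in> hom C (B && W) (B && Z)" by (rule ty)+
  have "?P ;; pull A B Y Z f G
      = \<langle>?P ;; pr1 C A Z, ?P ;; (times_id C A Z f ;; G ;; pr2 C B Y)\<rangle>"
    unfolding pull_def[of A B Y] by (rule tup_cmp) (rule ty)+
  also have "?P ;; pr1 C A Z = pr1 C A W"
    by (rule pull_pr1) (rule ty)+
  also have "?P ;; (times_id C A Z f ;; G ;; pr2 C B Y) = ?P ;; times_id C A Z f ;; G ;; pr2 C B Y"
    by (rule cmp_assoc_left[symmetric]) (rule ty)+
  also have "?P ;; times_id C A Z f = times_id C A W f ;; ?Q"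
    by (rule pull_times_id[OF f Q pull_pr1[OF g H(1)]])
  also have "times_id C A W f ;; ?Q ;; G = times_id C A W f ;; (?Q ;; G)"
    by (rule cmp_assoc) (rule ty)+
  finally show ?thesis unfolding pull_cmp_base[OF f g H(1)] pull_def[of A B Y] .
qed

lemma category_ELens: "category (ELens C)"
proof
  fix A :: "'o \<times> 'o"
  obtain a x where A: "A = (a, x)" by force
  show "\<one>\<^bsub>ELens C\<^esub> A \<in> hom (ELens C) A A"
    by (simp add: A ELens_hom_iff ELens_ident times_id_ident ident_hom ident_cmp[OF pr1_hom])
next
  fix u v and A B D :: "'o \<times> 'o"
  assume u: "u \<in> hom (ELens C) A B" and v: "v \<in> hom (ELens C) B D"
  obtain a x b y d z where O: "A = (a, x)" "B = (b, y)" "D = (d, z)" by (metis surj_pair)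
  from u v obtain f F g G where u_eq: "u = Arrow (a, x) (Lens f F (times_id C a y f)) (b, y)"
    and v_eq: "v = Arrow (b, y) (Lens g G (times_id C b z g)) (d, z)"
    and ty: "f \<in> hom C a b" "g \<in> hom C b d" "F \<in> hom C (a && y) (a && x)"
      "G \<in> hom C (b && z) (b && y)"
    and eq: "F ;; pr1 C a x = pr1 C a y"
    unfolding O ELens_hom_iff by blast
  have "pull a b y z f G ;; F ;; pr1 C a x = pull a b y z f G ;; (F ;; pr1 C a x)"
    by (rule cmp_assoc) (rule pull_hom pr1_hom ty)+
  then have "pull a b y z f G ;; F ;; pr1 C a x = pr1 C a z"
    by (simp add: eq pull_pr1[OF ty(1,4)])
  moreover have "f ;; g \<in> hom C a d" "pull a b y z f G ;; F \<in> hom C (a && z) (a && x)"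
    by (rule cmp_hom pull_hom ty)+
  ultimately show "u ;;\<^bsub>ELens C\<^esub> v \<in> hom (ELens C) A D"
    unfolding O u_eq v_eq ELens_cmp ELens_hom_iff by blast
next
  fix u v w and A B D E :: "'o \<times> 'o"
  assume u: "u \<in> hom (ELens C) A B" and v: "v \<in> hom (ELens C) B D"
    and w: "w \<in> hom (ELens C) D E"
  obtain a x b y d z e t where O: "A = (a, x)" "B = (b, y)" "D = (d, z)" "E = (e, t)"
    by (metis surj_pair)
  from u v w obtain f F g G h H
    where u_eq: "u = Arrow (a, x) (Lens f F (times_id C a y f)) (b, y)"
    and v_eq: "v = Arrow (b, y) (Lens g G (times_id C b z g)) (d, z)"
    and w_eq: "w = Arrow (d, z) (Lens h H (times_id C d t h)) (e, t)"
    and ty: "f \<in> hom C a b" "g \<in> hom C b d" "h \<in> hom C d e" "F \<in> hom C (a && y) (a && x)"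
      "G \<in> hom C (b && z) (b && y)" "H \<in> hom C (d && t) (d && z)"
    and eq: "H ;; pr1 C d z = pr1 C d t"
    unfolding O ELens_hom_iff by blast
  have "pull a d z t (f ;; g) H ;; (pull a b y z f G ;; F)
      = pull a d z t (f ;; g) H ;; pull a b y z f G ;; F"
    by (rule cmp_assoc[symmetric]) (rule cmp_hom pull_hom ty)+
  then show "u ;;\<^bsub>ELens C\<^esub> v ;;\<^bsub>ELens C\<^esub> w = u ;;\<^bsub>ELens C\<^esub> (v ;;\<^bsub>ELens C\<^esub> w)"
    by (simp add: u_eq v_eq w_eq ELens_cmp cmp_assoc[OF ty(1,2,3)]
      pull_pull[OF ty(1,2,5,6) eq])
next
  fix u and A B :: "'o \<times> 'o"
  assume u: "u \<in> hom (ELens C) A B"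
  obtain a x b y where O: "A = (a, x)" "B = (b, y)" by (metis surj_pair)
  from u obtain f F where u_eq: "u = Arrow (a, x) (Lens f F (times_id C a y f)) (b, y)"
    and ty: "f \<in> hom C a b" "F \<in> hom C (a && y) (a && x)" and eq: "F ;; pr1 C a x = pr1 C a y"
    unfolding O ELens_hom_iff by blast
  show "\<one>\<^bsub>ELens C\<^esub> A ;;\<^bsub>ELens C\<^esub> u = u"
    by (simp add: O u_eq ELens_ident ELens_cmp ident_cmp[OF ty(1)] cmp_ident[OF ty(2)]
      pull_ident_base[OF ty(2) eq])
  show "u ;;\<^bsub>ELens C\<^esub> \<one>\<^bsub>ELens C\<^esub> B = u"
    by (simp add: O u_eq ELens_ident ELens_cmp cmp_ident[OF ty(1)] ident_cmp[OF ty(2)]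
      pull_ident[OF ty(1)])
qed

end

section \<open>Isomorphisms and the symmetry\<close>

context category
begin

lemma inverse_arrows_unique:
  assumes "inverse_arrows C A B f g" "inverse_arrows C A B f g'"
  shows "g = g'"
proof -
  have "g ;; f ;; g' = g ;; (f ;; g')"
    using assms by (intro cmp_assoc) (auto simp: inverse_arrows_def)
  then show ?thesis using assms by (auto simp: inverse_arrows_def ident_cmp cmp_ident)
qed

lemma inverse_arrows_cmp:
  assumes "inverse_arrows C A B f f'" "inverse_arrows C B D g g'"
  shows "inverse_arrows C A D (f ;; g) (g' ;; f')"
proof -
  have ty: "f \<in> hom C A B" "f' \<in> hom C B A" "g \<in> hom C B D" "g' \<in> hom C D B"
    and eq: "f ;; f' = \<one> A" "f' ;; f = \<one> B" "g ;; g' = \<one> B" "g' ;; g = \<one> D"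
    using assms by (simp_all add: inverse_arrows_def)
  have "f ;; g ;; (g' ;; f') = f ;; (g ;; g' ;; f')" "g' ;; f' ;; (f ;; g) = g' ;; (f' ;; f ;; g)"
    by (simp_all add: cmp_assoc[OF ty(1,3) cmp_hom[OF ty(4,2)]] cmp_assoc[OF ty(3,4,2)]
      cmp_assoc[OF ty(4,2) cmp_hom[OF ty(1,3)]] cmp_assoc[OF ty(2,1,3)])
  then show ?thesis
    by (simp add: inverse_arrows_def eq ident_cmp[OF ty(2)] ident_cmp[OF ty(3)]
      cmp_hom[OF ty(1,3)] cmp_hom[OF ty(4,2)])
qed

lemma inverse_arrows_transpose:
  assumes "inverse_arrows C A B f g" "h \<in> hom C A D"
  shows "g ;; h = k \<Longrightarrow> h = f ;; k"
proof -
  assume k: "g ;; h = k"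
  have "f ;; g ;; h = f ;; (g ;; h)"
    using assms by (intro cmp_assoc) (auto simp: inverse_arrows_def)
  then show "h = f ;; k" using assms by (simp add: inverse_arrows_def ident_cmp k)
qed

lemma inverse_arrows_square:
  assumes a: "inverse_arrows C A B a a'" and b: "inverse_arrows C D E b b'"
    and "p \<in> hom C A D" "q \<in> hom C B E" and eq: "q ;; b' = a' ;; p"
  shows "p ;; b = a ;; q"
proof -
  have ty: "a \<in> hom C A B" "a' \<in> hom C B A" "b \<in> hom C D E" "b' \<in> hom C E D"
    "p \<in> hom C A D" "q \<in> hom C B E"
    using assms by (simp_all add: inverse_arrows_def)
  show ?thesis
  proof (rule inverse_arrows_transpose[OF a])
    show "p ;; b \<in> hom C A E" by (rule cmp_hom ty)+
    have "a' ;; (p ;; b) = a' ;; p ;; b" by (rule cmp_assoc[symmetric]) (rule ty)+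
    also have "\<dots> = q ;; (b' ;; b)" unfolding eq[symmetric] by (rule cmp_assoc) (rule ty)+
    also have "\<dots> = q" using b by (simp add: inverse_arrows_def cmp_ident[OF ty(6)])
    finally show "a' ;; (p ;; b) = q" .
  qed
qed

end

context monoidal_cat
begin

lemma tensor_cmp_l:
  assumes "f \<in> hom C A A'" "f' \<in> hom C A' A''"
  shows "(f ;; f') \<otimes>\<^sub>m \<one> B = (f \<otimes>\<^sub>m \<one> B) ;; (f' \<otimes>\<^sub>m \<one> B)"
  using tensor_cmp[OF assms ident_hom ident_hom, of B] by (simp add: ident_cmp[OF ident_hom])

lemma tensor_cmp_r:
  assumes "f \<in> hom C A A'" "f' \<in> hom C A' A''"
  shows "\<one> B \<otimes>\<^sub>m (f ;; f') = (\<one> B \<otimes>\<^sub>m f) ;; (\<one> B \<otimes>\<^sub>m f')"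
  using tensor_cmp[OF ident_hom ident_hom assms, of B] by (simp add: ident_cmp[OF ident_hom])

lemma tensor_split:
  assumes "f \<in> hom C A A'" "g \<in> hom C B B'"
  shows "(f \<otimes>\<^sub>m \<one> B) ;; (\<one> A' \<otimes>\<^sub>m g) = f \<otimes>\<^sub>m g" "(\<one> A \<otimes>\<^sub>m g) ;; (f \<otimes>\<^sub>m \<one> B') = f \<otimes>\<^sub>m g"
  using tensor_cmp[OF assms(1) ident_hom ident_hom assms(2)]
    tensor_cmp[OF ident_hom assms(1) assms(2) ident_hom]
  by (simp_all add: ident_cmp[OF assms(1)] cmp_ident[OF assms(1)] ident_cmp[OF assms(2)]
    cmp_ident[OF assms(2)])

lemma assoc_hom: "\<a> A B D \<in> hom C ((A \<otimes> B) \<otimes> D) (A \<otimes> (B \<otimes> D))"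
  and assoc_inv_hom: "\<a>_inv A B D \<in> hom C (A \<otimes> (B \<otimes> D)) ((A \<otimes> B) \<otimes> D)"
  and lunit_hom: "\<l> A \<in> hom C (\<I> \<otimes> A) A"
  and runit_hom: "\<r> A \<in> hom C (A \<otimes> \<I>) A"
  using assoc_iso[of A B D] lunit_iso[of A] runit_iso[of A] by (simp_all add: inverse_arrows_def)

lemmas tensor_typing = ident_hom cmp_hom tensor_hom assoc_hom assoc_inv_hom lunit_hom runit_hom
  symm_hom

lemma symm_iso: "inverse_arrows C (A \<otimes> B) (B \<otimes> A) (\<s> A B) (\<s> B A)"
  by (simp add: inverse_arrows_def symm_hom symm_symm)

lemma inverse_arrows_tensor:
  assumes "inverse_arrows C A A' f f'" "inverse_arrows C B B' g g'"
  shows "inverse_arrows C (A \<otimes> B) (A' \<otimes> B') (f \<otimes>\<^sub>m g) (f' \<otimes>\<^sub>m g')"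
  using assms tensor_cmp[of f A A' f' A g B B' g' B] tensor_cmp[of f' A' A f A' g' B' B g B']
  by (simp add: inverse_arrows_def tensor_hom tensor_ident)

lemma ident_iso: "inverse_arrows C A A (\<one> A) (\<one> A)"
  by (simp add: inverse_arrows_def ident_hom ident_cmp[OF ident_hom])

text \<open>The two sides are the inverses of the two sides of the hexagon axiom.\<close>

lemma hexagon_inv:
  "\<a>_inv B D A ;; (\<s> (B \<otimes> D) A ;; \<a>_inv A B D)
     = (\<one> B \<otimes>\<^sub>m \<s> D A) ;; (\<a>_inv B A D ;; (\<s> B A \<otimes>\<^sub>m \<one> D))"
proof (rule inverse_arrows_unique)
  show "inverse_arrows C ((A \<otimes> B) \<otimes> D) (B \<otimes> (D \<otimes> A)) (\<a> A B D ;; \<s> A (B \<otimes> D) ;; \<a> B D A)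
      (\<a>_inv B D A ;; (\<s> (B \<otimes> D) A ;; \<a>_inv A B D))"
    by (rule inverse_arrows_cmp assoc_iso symm_iso)+
  show "inverse_arrows C ((A \<otimes> B) \<otimes> D) (B \<otimes> (D \<otimes> A)) (\<a> A B D ;; \<s> A (B \<otimes> D) ;; \<a> B D A)
      ((\<one> B \<otimes>\<^sub>m \<s> D A) ;; (\<a>_inv B A D ;; (\<s> B A \<otimes>\<^sub>m \<one> D)))"
    unfolding hexagon
    by (rule inverse_arrows_cmp inverse_arrows_tensor ident_iso assoc_iso symm_iso)+
qed

text \<open>Both sides send \<open>(x \<otimes> y) \<otimes> a\<close> to \<open>(a \<otimes> y) \<otimes> x\<close>.  This is how a direction \<open>a\<close> moves past two base
  points at the cost of exchanging them.\<close>

lemma symm_reverse: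
  "(\<s> X Y \<otimes>\<^sub>m \<one> A) ;; (\<s> (Y \<otimes> X) A ;; \<a>_inv A Y X)
     = \<a> X Y A ;; ((\<one> X \<otimes>\<^sub>m \<s> Y A) ;; \<s> X (A \<otimes> Y))"
proof -
  note ty = tensor_typing
  let ?mid = "\<a> Y X A ;; ((\<one> Y \<otimes>\<^sub>m \<s> X A) ;; (\<a>_inv Y A X ;; (\<s> Y A \<otimes>\<^sub>m \<one> X)))"
  have r: "\<s> (Y \<otimes> X) A ;; \<a>_inv A Y X = ?mid"
    by (rule inverse_arrows_transpose[OF assoc_iso]) (rule ty hexagon_inv)+
  have "\<a> X Y A ;; ((\<one> X \<otimes>\<^sub>m \<s> Y A) ;; \<s> X (A \<otimes> Y))
      = \<a> X Y A ;; (\<s> X (Y \<otimes> A) ;; (\<s> Y A \<otimes>\<^sub>m \<one> X))"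
    using symm_nat[OF ident_hom symm_hom, of X Y A] by simp
  also have "\<dots> = \<a> X Y A ;; \<s> X (Y \<otimes> A) ;; (\<s> Y A \<otimes>\<^sub>m \<one> X)"
    by (rule cmp_assoc[symmetric]) (rule ty)+
  also have "\<a> X Y A ;; \<s> X (Y \<otimes> A)
      = (\<s> X Y \<otimes>\<^sub>m \<one> A) ;; \<a> Y X A ;; (\<one> Y \<otimes>\<^sub>m \<s> X A) ;; \<a>_inv Y A X"
  proof -
    have "\<a> X Y A ;; \<s> X (Y \<otimes> A) = \<a> X Y A ;; \<s> X (Y \<otimes> A) ;; (\<a> Y A X ;; \<a>_inv Y A X)"
      using assoc_iso[of Y A X] cmp_ident[OF cmp_hom[OF assoc_hom symm_hom]]
      by (simp add: inverse_arrows_def)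
    also have "\<dots> = \<a> X Y A ;; \<s> X (Y \<otimes> A) ;; \<a> Y A X ;; \<a>_inv Y A X"
      by (rule cmp_assoc[symmetric]) (rule ty)+
    finally show ?thesis unfolding hexagon .
  qed
  also have "(\<s> X Y \<otimes>\<^sub>m \<one> A) ;; \<a> Y X A ;; (\<one> Y \<otimes>\<^sub>m \<s> X A) ;; \<a>_inv Y A X ;; (\<s> Y A \<otimes>\<^sub>m \<one> X)
      = (\<s> X Y \<otimes>\<^sub>m \<one> A) ;; \<a> Y X A ;; (\<one> Y \<otimes>\<^sub>m \<s> X A) ;; (\<a>_inv Y A X ;; (\<s> Y A \<otimes>\<^sub>m \<one> X))"
    by (rule cmp_assoc) (rule ty)+
  also have "\<dots> = (\<s> X Y \<otimes>\<^sub>m \<one> A) ;; (\<a> Y X A ;; (\<one> Y \<otimes>\<^sub>m \<s> X A) ;; (\<a>_inv Y A X ;; (\<s> Y A \<otimes>\<^sub>m \<one> X)))"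
    by (rule cmp_assoc_left) (rule ty)+
  also have "\<a> Y X A ;; (\<one> Y \<otimes>\<^sub>m \<s> X A) ;; (\<a>_inv Y A X ;; (\<s> Y A \<otimes>\<^sub>m \<one> X)) = ?mid"
    by (rule cmp_assoc) (rule ty)+
  finally show ?thesis by (simp only: r)
qed

end

section \<open>Storage modalities\<close>

context storage_cat
begin

lemma counit_hom: "counit C A \<in> hom C (\<^bold>! A) \<I>"
  unfolding counit_def using seely0_iso by (auto simp: inverse_arrows_def intro: cmp_hom weak_hom)

lemma seely_hom: "seely C A B \<in> hom C (\<^bold>! A \<otimes> \<^bold>! B) (\<^bold>! (A && B))"
  and seely_inv_hom: "seely_inv C A B \<in> hom C (\<^bold>! (A && B)) (\<^bold>! A \<otimes> \<^bold>! B)"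
  using seely_iso[of A B] by (simp_all add: inverse_arrows_def)

lemmas storage_typing = tensor_typing pr1_hom pr2_hom tup_hom add_hom zero_hom bang_hom der_hom
  dig_hom contr_hom counit_hom seely_hom seely_inv_hom

lemma counit_nat:
  assumes "f \<in> hom C A B"
  shows "\<^bold>!\<^sub>m f ;; counit C B = counit C A"
proof -
  have "\<^bold>!\<^sub>m f ;; (weak C B ;; seely0_inv C) = \<^bold>!\<^sub>m f ;; weak C B ;; seely0_inv C"
    using seely0_iso
    by (intro cmp_assoc[symmetric]) (auto simp: inverse_arrows_def intro: weak_hom bang_hom assms)
  then show ?thesis by (simp add: counit_def weak_nat[OF assms])
qed

lemma contr_counit_right: "contr C A ;; (\<one> (\<^bold>! A) \<otimes>\<^sub>m counit C A) ;; \<r> (\<^bold>! A) = \<one> (\<^bold>! A)"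
proof -
  note ty = storage_typing
  have "(\<one> (\<^bold>! A) \<otimes>\<^sub>m counit C A) ;; \<r> (\<^bold>! A) = (\<one> (\<^bold>! A) \<otimes>\<^sub>m counit C A) ;; (\<s> (\<^bold>! A) \<I> ;; \<l> (\<^bold>! A))"
    by (simp only: symm_unit)
  also have "\<dots> = (\<one> (\<^bold>! A) \<otimes>\<^sub>m counit C A) ;; \<s> (\<^bold>! A) \<I> ;; \<l> (\<^bold>! A)"
    by (rule cmp_assoc[symmetric]) (rule ty)+
  also have "(\<one> (\<^bold>! A) \<otimes>\<^sub>m counit C A) ;; \<s> (\<^bold>! A) \<I> = \<s> (\<^bold>! A) (\<^bold>! A) ;; (counit C A \<otimes>\<^sub>m \<one> (\<^bold>! A))"
    by (rule symm_nat) (rule ty)+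
  finally have *: "(\<one> (\<^bold>! A) \<otimes>\<^sub>m counit C A) ;; \<r> (\<^bold>! A)
      = \<s> (\<^bold>! A) (\<^bold>! A) ;; (counit C A \<otimes>\<^sub>m \<one> (\<^bold>! A)) ;; \<l> (\<^bold>! A)" .
  have "contr C A ;; (\<one> (\<^bold>! A) \<otimes>\<^sub>m counit C A) ;; \<r> (\<^bold>! A)
      = contr C A ;; ((\<one> (\<^bold>! A) \<otimes>\<^sub>m counit C A) ;; \<r> (\<^bold>! A))"
    by (rule cmp_assoc) (rule ty)+
  also have "\<dots> = contr C A ;; \<s> (\<^bold>! A) (\<^bold>! A) ;; (counit C A \<otimes>\<^sub>m \<one> (\<^bold>! A)) ;; \<l> (\<^bold>! A)"
    unfolding * by (rule cmp_assoc_left[symmetric]) (rule ty)+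
  finally show ?thesis by (simp only: contr_symm contr_counit)
qed

text \<open>Naturality of contraction makes the inverse Seely map compute on arbitrary pairings.\<close>

lemma bang_tup_seely_inv:
  assumes u: "u \<in> hom C X A" and v: "v \<in> hom C X B"
  shows "\<^bold>!\<^sub>m \<langle>u, v\<rangle> ;; seely_inv C A B = contr C X ;; (\<^bold>!\<^sub>m u \<otimes>\<^sub>m \<^bold>!\<^sub>m v)"
proof -
  note ty = storage_typing u v
  let ?t = "\<langle>u, v\<rangle>" and ?p = "\<^bold>!\<^sub>m (pr1 C A B) \<otimes>\<^sub>m \<^bold>!\<^sub>m (pr2 C A B)"
  have "\<^bold>!\<^sub>m ?t ;; seely_inv C A B = \<^bold>!\<^sub>m ?t ;; contr C (A && B) ;; ?p"
    unfolding seely_inv_def by (rule cmp_assoc[symmetric]) (rule ty)+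
  also have "\<^bold>!\<^sub>m ?t ;; contr C (A && B) = contr C X ;; (\<^bold>!\<^sub>m ?t \<otimes>\<^sub>m \<^bold>!\<^sub>m ?t)"
    by (rule contr_nat) (rule ty)+
  also have "contr C X ;; (\<^bold>!\<^sub>m ?t \<otimes>\<^sub>m \<^bold>!\<^sub>m ?t) ;; ?p = contr C X ;; ((\<^bold>!\<^sub>m ?t \<otimes>\<^sub>m \<^bold>!\<^sub>m ?t) ;; ?p)"
    by (rule cmp_assoc) (rule ty)+
  also have "(\<^bold>!\<^sub>m ?t \<otimes>\<^sub>m \<^bold>!\<^sub>m ?t) ;; ?p = (\<^bold>!\<^sub>m ?t ;; \<^bold>!\<^sub>m (pr1 C A B)) \<otimes>\<^sub>m (\<^bold>!\<^sub>m ?t ;; \<^bold>!\<^sub>m (pr2 C A B))"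
    by (rule tensor_cmp[symmetric]) (rule ty)+
  also have "\<^bold>!\<^sub>m ?t ;; \<^bold>!\<^sub>m (pr1 C A B) = \<^bold>!\<^sub>m u"
    using bang_cmp[OF tup_hom[OF u v] pr1_hom] by (simp add: tup_pr1[OF u v])
  also have "\<^bold>!\<^sub>m ?t ;; \<^bold>!\<^sub>m (pr2 C A B) = \<^bold>!\<^sub>m v"
    using bang_cmp[OF tup_hom[OF u v] pr2_hom] by (simp add: tup_pr2[OF u v])
  finally show ?thesis .
qed

text \<open>Naturality is easy for the inverse, which has an explicit formula; it then passes to the
  isomorphism itself.\<close>

lemma seely_nat:
  assumes f: "f \<in> hom C A A'" and g: "g \<in> hom C B B'"
  shows "(\<^bold>!\<^sub>m f \<otimes>\<^sub>m \<^bold>!\<^sub>m g) ;; seely C A' B' = seely C A B ;; \<^bold>!\<^sub>m \<langle>pr1 C A B ;; f, pr2 C A B ;; g\<rangle>"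
proof (rule inverse_arrows_square[OF seely_iso seely_iso])
  note ty = storage_typing f g
  show "\<^bold>!\<^sub>m f \<otimes>\<^sub>m \<^bold>!\<^sub>m g \<in> hom C (\<^bold>! A \<otimes> \<^bold>! B) (\<^bold>! A' \<otimes> \<^bold>! B')"
    "\<^bold>!\<^sub>m \<langle>pr1 C A B ;; f, pr2 C A B ;; g\<rangle> \<in> hom C (\<^bold>! (A && B)) (\<^bold>! (A' && B'))"
    by (rule ty)+
  have "\<^bold>!\<^sub>m \<langle>pr1 C A B ;; f, pr2 C A B ;; g\<rangle> ;; seely_inv C A' B'
      = contr C (A && B) ;; (\<^bold>!\<^sub>m (pr1 C A B ;; f) \<otimes>\<^sub>m \<^bold>!\<^sub>m (pr2 C A B ;; g))"
    by (rule bang_tup_seely_inv) (rule ty)+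
  also have "\<^bold>!\<^sub>m (pr1 C A B ;; f) \<otimes>\<^sub>m \<^bold>!\<^sub>m (pr2 C A B ;; g)
      = (\<^bold>!\<^sub>m (pr1 C A B) \<otimes>\<^sub>m \<^bold>!\<^sub>m (pr2 C A B)) ;; (\<^bold>!\<^sub>m f \<otimes>\<^sub>m \<^bold>!\<^sub>m g)"
    unfolding bang_cmp[OF pr1_hom f] bang_cmp[OF pr2_hom g] by (rule tensor_cmp) (rule ty)+
  also have "contr C (A && B) ;; \<dots> = seely_inv C A B ;; (\<^bold>!\<^sub>m f \<otimes>\<^sub>m \<^bold>!\<^sub>m g)"
    unfolding seely_inv_def by (rule cmp_assoc[symmetric]) (rule ty)+
  finally show "\<^bold>!\<^sub>m \<langle>pr1 C A B ;; f, pr2 C A B ;; g\<rangle> ;; seely_inv C A' B'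
      = seely_inv C A B ;; (\<^bold>!\<^sub>m f \<otimes>\<^sub>m \<^bold>!\<^sub>m g)" .
qed

text \<open>Under the Seely isomorphism a projection becomes the discarding of one factor, because the
  inverse map starts with a contraction and the discarded copy is removed by a counit law.\<close>

lemma seely_pr1: "\<^bold>!\<^sub>m (pr1 C A B) = seely_inv C A B ;; ((\<one> (\<^bold>! A) \<otimes>\<^sub>m counit C B) ;; \<r> (\<^bold>! A))"
  and seely_pr2: "\<^bold>!\<^sub>m (pr2 C A B) = seely_inv C A B ;; ((counit C A \<otimes>\<^sub>m \<one> (\<^bold>! B)) ;; \<l> (\<^bold>! B))"
proof -
  note ty = storage_typing
  let ?c = "contr C (A && B)" and ?p = "\<^bold>!\<^sub>m (pr1 C A B)" and ?q = "\<^bold>!\<^sub>m (pr2 C A B)"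
    and ?X = "\<^bold>! (A && B)"
  have p: "?p \<in> hom C ?X (\<^bold>! A)" and q: "?q \<in> hom C ?X (\<^bold>! B)" by (rule ty)+
  have "seely_inv C A B ;; ((\<one> (\<^bold>! A) \<otimes>\<^sub>m counit C B) ;; \<r> (\<^bold>! A))
      = seely_inv C A B ;; (\<one> (\<^bold>! A) \<otimes>\<^sub>m counit C B) ;; \<r> (\<^bold>! A)"
    by (rule cmp_assoc[symmetric]) (rule ty)+
  also have "\<dots> = ?c ;; ((?p \<otimes>\<^sub>m ?q) ;; (\<one> (\<^bold>! A) \<otimes>\<^sub>m counit C B) ;; \<r> (\<^bold>! A))"
    unfolding seely_inv_def by (rule cmp_assoc_left) (rule ty)+
  also have "(?p \<otimes>\<^sub>m ?q) ;; (\<one> (\<^bold>! A) \<otimes>\<^sub>m counit C B) = ?p \<otimes>\<^sub>m counit C (A && B)"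
    using tensor_cmp[OF p ident_hom q counit_hom]
    by (simp add: cmp_ident[OF p] counit_nat[OF pr2_hom])
  also have "\<dots> = (\<one> ?X \<otimes>\<^sub>m counit C (A && B)) ;; (?p \<otimes>\<^sub>m \<one> \<I>)"
    by (rule tensor_split(2)[symmetric]) (rule ty)+
  also have "?c ;; (\<dots> ;; \<r> (\<^bold>! A)) = ?c ;; ((\<one> ?X \<otimes>\<^sub>m counit C (A && B)) ;; ((?p \<otimes>\<^sub>m \<one> \<I>) ;; \<r> (\<^bold>! A)))"
    by (subst cmp_assoc) (rule ty refl)+
  also have "(?p \<otimes>\<^sub>m \<one> \<I>) ;; \<r> (\<^bold>! A) = \<r> ?X ;; ?p"
    by (rule runit_nat[OF p])
  also have "(\<one> ?X \<otimes>\<^sub>m counit C (A && B)) ;; (\<r> ?X ;; ?p) = (\<one> ?X \<otimes>\<^sub>m counit C (A && B)) ;; \<r> ?X ;; ?p"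
    by (rule cmp_assoc[symmetric]) (rule ty)+
  also have "?c ;; \<dots> = ?c ;; (\<one> ?X \<otimes>\<^sub>m counit C (A && B)) ;; \<r> ?X ;; ?p"
    by (rule cmp_assoc_left[symmetric]) (rule ty)+
  finally show "?p = seely_inv C A B ;; ((\<one> (\<^bold>! A) \<otimes>\<^sub>m counit C B) ;; \<r> (\<^bold>! A))"
    by (simp only: contr_counit_right ident_cmp[OF p])
  have "seely_inv C A B ;; ((counit C A \<otimes>\<^sub>m \<one> (\<^bold>! B)) ;; \<l> (\<^bold>! B))
      = seely_inv C A B ;; (counit C A \<otimes>\<^sub>m \<one> (\<^bold>! B)) ;; \<l> (\<^bold>! B)"
    by (rule cmp_assoc[symmetric]) (rule ty)+
  also have "\<dots> = ?c ;; ((?p \<otimes>\<^sub>m ?q) ;; (counit C A \<otimes>\<^sub>m \<one> (\<^bold>! B)) ;; \<l> (\<^bold>! B))"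
    unfolding seely_inv_def by (rule cmp_assoc_left) (rule ty)+
  also have "(?p \<otimes>\<^sub>m ?q) ;; (counit C A \<otimes>\<^sub>m \<one> (\<^bold>! B)) = counit C (A && B) \<otimes>\<^sub>m ?q"
    using tensor_cmp[OF p counit_hom q ident_hom]
    by (simp add: cmp_ident[OF q] counit_nat[OF pr1_hom])
  also have "\<dots> = (counit C (A && B) \<otimes>\<^sub>m \<one> ?X) ;; (\<one> \<I> \<otimes>\<^sub>m ?q)"
    by (rule tensor_split(1)[symmetric]) (rule ty)+
  also have "?c ;; (\<dots> ;; \<l> (\<^bold>! B)) = ?c ;; ((counit C (A && B) \<otimes>\<^sub>m \<one> ?X) ;; ((\<one> \<I> \<otimes>\<^sub>m ?q) ;; \<l> (\<^bold>! B)))"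
    by (subst cmp_assoc) (rule ty refl)+
  also have "(\<one> \<I> \<otimes>\<^sub>m ?q) ;; \<l> (\<^bold>! B) = \<l> ?X ;; ?q"
    by (rule lunit_nat[OF q])
  also have "(counit C (A && B) \<otimes>\<^sub>m \<one> ?X) ;; (\<l> ?X ;; ?q) = (counit C (A && B) \<otimes>\<^sub>m \<one> ?X) ;; \<l> ?X ;; ?q"
    by (rule cmp_assoc[symmetric]) (rule ty)+
  also have "?c ;; \<dots> = ?c ;; (counit C (A && B) \<otimes>\<^sub>m \<one> ?X) ;; \<l> ?X ;; ?q"
    by (rule cmp_assoc_left[symmetric]) (rule ty)+
  finally show "?q = seely_inv C A B ;; ((counit C A \<otimes>\<^sub>m \<one> (\<^bold>! B)) ;; \<l> (\<^bold>! B))"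
    by (simp only: contr_counit ident_cmp[OF q])
qed

lemma codiag_hom: "codiag C A \<in> hom C (A && A) A"
  unfolding codiag_def by (rule storage_typing)+

lemma cocontr_hom: "cocontr C A \<in> hom C (\<^bold>! A \<otimes> \<^bold>! A) (\<^bold>! A)"
  unfolding cocontr_def by (rule storage_typing codiag_hom)+

lemma codiag_nat:
  assumes f: "f \<in> hom C A B"
  shows "\<langle>pr1 C A A ;; f, pr2 C A A ;; f\<rangle> ;; codiag C B = codiag C A ;; f"
proof -
  note ty = storage_typing f
  have pf: "pr1 C A A ;; f \<in> hom C (A && A) B" "pr2 C A A ;; f \<in> hom C (A && A) B"
    by (rule ty)+
  show ?thesis
    unfolding codiag_def
    by (simp add: cmp_add[OF tup_hom[OF pf] pr1_hom pr2_hom] tup_pr1[OF pf] tup_pr2[OF pf]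
      add_cmp[OF pr1_hom pr2_hom f])
qed

lemma cocontr_nat:
  assumes f: "f \<in> hom C A B"
  shows "(\<^bold>!\<^sub>m f \<otimes>\<^sub>m \<^bold>!\<^sub>m f) ;; cocontr C B = cocontr C A ;; \<^bold>!\<^sub>m f"
proof -
  note ty = storage_typing codiag_hom f
  let ?ff = "\<langle>pr1 C A A ;; f, pr2 C A A ;; f\<rangle>"
  have ff: "?ff \<in> hom C (A && A) (B && B)" by (rule ty)+
  have "(\<^bold>!\<^sub>m f \<otimes>\<^sub>m \<^bold>!\<^sub>m f) ;; cocontr C B = (\<^bold>!\<^sub>m f \<otimes>\<^sub>m \<^bold>!\<^sub>m f) ;; seely C B B ;; \<^bold>!\<^sub>m (codiag C B)"
    unfolding cocontr_def by (rule cmp_assoc[symmetric]) (rule ty)+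
  also have "\<dots> = seely C A A ;; \<^bold>!\<^sub>m ?ff ;; \<^bold>!\<^sub>m (codiag C B)"
    by (simp only: seely_nat[OF f f])
  also have "\<dots> = seely C A A ;; (\<^bold>!\<^sub>m ?ff ;; \<^bold>!\<^sub>m (codiag C B))"
    by (rule cmp_assoc) (rule ty)+
  also have "\<dots> = seely C A A ;; (\<^bold>!\<^sub>m (codiag C A) ;; \<^bold>!\<^sub>m f)"
    by (simp only: bang_cmp[OF ff codiag_hom, symmetric] codiag_nat[OF f] bang_cmp[OF codiag_hom f])
  also have "\<dots> = cocontr C A ;; \<^bold>!\<^sub>m f"
    unfolding cocontr_def by (rule cmp_assoc[symmetric]) (rule ty)+
  finally show ?thesis .
qed

text \<open>Dereliction of a cocontraction is the Leibniz sum: \<open>d\<close> is natural for the codiagonal, which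
  is the sum of the two projections, and each projection discards one factor.\<close>

lemma cocontr_der:
  "cocontr C A ;; der C A = (\<one> (\<^bold>! A) \<otimes>\<^sub>m counit C A) ;; \<r> (\<^bold>! A) ;; der C A
     \<oplus> (counit C A \<otimes>\<^sub>m \<one> (\<^bold>! A)) ;; \<l> (\<^bold>! A) ;; der C A"
proof -
  note ty = storage_typing codiag_hom
  let ?p = "pr1 C A A" and ?q = "pr2 C A A" and ?s = "seely C A A"
  have d: "der C (A && A) \<in> hom C (\<^bold>! (A && A)) (A && A)" by (rule ty)
  have "cocontr C A ;; der C A = ?s ;; (\<^bold>!\<^sub>m (codiag C A) ;; der C A)"
    unfolding cocontr_def by (rule cmp_assoc) (rule ty)+
  also have "\<^bold>!\<^sub>m (codiag C A) ;; der C A = der C (A && A) ;; codiag C A"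
    by (rule der_nat) (rule ty)
  also have "\<dots> = \<^bold>!\<^sub>m ?p ;; der C A \<oplus> \<^bold>!\<^sub>m ?q ;; der C A"
    unfolding codiag_def
    by (simp only: cmp_add[OF d pr1_hom pr2_hom] der_nat[OF pr1_hom] der_nat[OF pr2_hom])
  also have "?s ;; \<dots> = ?s ;; (\<^bold>!\<^sub>m ?p ;; der C A) \<oplus> ?s ;; (\<^bold>!\<^sub>m ?q ;; der C A)"
    by (rule cmp_add) (rule ty)+
  also have "?s ;; (\<^bold>!\<^sub>m ?p ;; der C A) = ?s ;; \<^bold>!\<^sub>m ?p ;; der C A"
    by (rule cmp_assoc[symmetric]) (rule ty)+
  also have "?s ;; \<^bold>!\<^sub>m ?p = (\<one> (\<^bold>! A) \<otimes>\<^sub>m counit C A) ;; \<r> (\<^bold>! A)"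
    by (rule inverse_arrows_transpose[OF seely_iso, symmetric]) (rule ty seely_pr1[symmetric])+
  also have "?s ;; (\<^bold>!\<^sub>m ?q ;; der C A) = ?s ;; \<^bold>!\<^sub>m ?q ;; der C A"
    by (rule cmp_assoc[symmetric]) (rule ty)+
  also have "?s ;; \<^bold>!\<^sub>m ?q = (counit C A \<otimes>\<^sub>m \<one> (\<^bold>! A)) ;; \<l> (\<^bold>! A)"
    by (rule inverse_arrows_transpose[OF seely_iso, symmetric]) (rule ty seely_pr2[symmetric])+
  finally show ?thesis .
qed

end

section \<open>The deriving transformation and transposition\<close>

context classical_dill
begin

lemma deriv_hom: "deriv C A \<in> hom C (A \<otimes> \<^bold>! A) (\<^bold>! A)"
  unfolding deriv_def by (rule storage_typing codr_hom cocontr_hom)+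

lemmas dill_typing = storage_typing codr_hom cocontr_hom deriv_hom

lemma deriv_nat:
  assumes f: "f \<in> hom C A B"
  shows "deriv C A ;; \<^bold>!\<^sub>m f = (f \<otimes>\<^sub>m \<^bold>!\<^sub>m f) ;; deriv C B"
proof -
  note ty = dill_typing f
  have fb: "\<^bold>!\<^sub>m f \<in> hom C (\<^bold>! A) (\<^bold>! B)" by (rule ty)+
  have "deriv C A ;; \<^bold>!\<^sub>m f = (codr C A \<otimes>\<^sub>m \<one> (\<^bold>! A)) ;; (cocontr C A ;; \<^bold>!\<^sub>m f)"
    unfolding deriv_def by (rule cmp_assoc) (rule ty)+
  also have "\<dots> = (codr C A \<otimes>\<^sub>m \<one> (\<^bold>! A)) ;; ((\<^bold>!\<^sub>m f \<otimes>\<^sub>m \<^bold>!\<^sub>m f) ;; cocontr C B)"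
    by (simp only: cocontr_nat[OF f])
  also have "\<dots> = (codr C A \<otimes>\<^sub>m \<one> (\<^bold>! A)) ;; (\<^bold>!\<^sub>m f \<otimes>\<^sub>m \<^bold>!\<^sub>m f) ;; cocontr C B"
    by (rule cmp_assoc[symmetric]) (rule ty)+
  also have "(codr C A \<otimes>\<^sub>m \<one> (\<^bold>! A)) ;; (\<^bold>!\<^sub>m f \<otimes>\<^sub>m \<^bold>!\<^sub>m f) = (f \<otimes>\<^sub>m \<^bold>!\<^sub>m f) ;; (codr C B \<otimes>\<^sub>m \<one> (\<^bold>! B))"
    using tensor_cmp[OF codr_hom fb ident_hom fb] tensor_cmp[OF f codr_hom fb ident_hom]
    by (simp add: codr_nat[OF f] ident_cmp[OF fb] cmp_ident[OF fb])
  also have "(f \<otimes>\<^sub>m \<^bold>!\<^sub>m f) ;; (codr C B \<otimes>\<^sub>m \<one> (\<^bold>! B)) ;; cocontr C B = (f \<otimes>\<^sub>m \<^bold>!\<^sub>m f) ;; deriv C B"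
    unfolding deriv_def by (rule cmp_assoc) (rule ty)+
  finally show ?thesis .
qed

text \<open>The derivative of a linear arrow does not depend on the base point: of the two Leibniz
  summands the one that dereliction takes from the base point dies because a codereliction has no
  constant part.\<close>

lemma deriv_der: "deriv C A ;; der C A = (\<one> A \<otimes>\<^sub>m counit C A) ;; \<r> A"
proof -
  note ty = dill_typing
  let ?c = "codr C A \<otimes>\<^sub>m \<one> (\<^bold>! A)" and ?e = "counit C A" and ?d = "der C A"
  have "deriv C A ;; ?d = ?c ;; (cocontr C A ;; ?d)"
    unfolding deriv_def by (rule cmp_assoc) (rule ty)+
  also have "\<dots> = ?c ;; ((\<one> (\<^bold>! A) \<otimes>\<^sub>m ?e) ;; \<r> (\<^bold>! A) ;; ?d) \<oplus> ?c ;; ((?e \<otimes>\<^sub>m \<one> (\<^bold>! A)) ;; \<l> (\<^bold>! A) ;; ?d)"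
    unfolding cocontr_der by (rule cmp_add) (rule ty)+
  also have "?c ;; ((\<one> (\<^bold>! A) \<otimes>\<^sub>m ?e) ;; \<r> (\<^bold>! A) ;; ?d) = ?c ;; (\<one> (\<^bold>! A) \<otimes>\<^sub>m ?e) ;; \<r> (\<^bold>! A) ;; ?d"
    by (rule cmp_assoc_left[symmetric]) (rule ty)+
  also have "?c ;; (\<one> (\<^bold>! A) \<otimes>\<^sub>m ?e) = (\<one> A \<otimes>\<^sub>m ?e) ;; (codr C A \<otimes>\<^sub>m \<one> \<I>)"
    using tensor_split[OF codr_hom counit_hom, of A A] by simp
  also have "(\<one> A \<otimes>\<^sub>m ?e) ;; (codr C A \<otimes>\<^sub>m \<one> \<I>) ;; \<r> (\<^bold>! A) ;; ?d
      = (\<one> A \<otimes>\<^sub>m ?e) ;; ((codr C A \<otimes>\<^sub>m \<one> \<I>) ;; \<r> (\<^bold>! A) ;; ?d)"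
    by (rule cmp_assoc_left) (rule ty)+
  also have "(codr C A \<otimes>\<^sub>m \<one> \<I>) ;; \<r> (\<^bold>! A) = \<r> A ;; codr C A"
    by (rule runit_nat) (rule ty)
  also have "\<r> A ;; codr C A ;; ?d = \<r> A ;; (codr C A ;; ?d)"
    by (rule cmp_assoc) (rule ty)+
  also have "\<dots> = \<r> A"
    by (simp only: codr_linear cmp_ident[OF runit_hom])
  also have "?c ;; ((?e \<otimes>\<^sub>m \<one> (\<^bold>! A)) ;; \<l> (\<^bold>! A) ;; ?d) = ?c ;; (?e \<otimes>\<^sub>m \<one> (\<^bold>! A)) ;; \<l> (\<^bold>! A) ;; ?d"
    by (rule cmp_assoc_left[symmetric]) (rule ty)+
  also have "?c ;; (?e \<otimes>\<^sub>m \<one> (\<^bold>! A)) = \<zero> (A \<otimes> \<^bold>! A) (\<I> \<otimes> \<^bold>! A)"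
    using tensor_cmp_l[OF codr_hom counit_hom, of A "\<^bold>! A"]
    by (simp add: codr_const zero_tensor[OF ident_hom])
  also have "\<dots> ;; \<l> (\<^bold>! A) ;; ?d = \<zero> (A \<otimes> \<^bold>! A) A"
    by (simp add: zero_cmp[OF lunit_hom] zero_cmp[OF der_hom])
  also have "(\<one> A \<otimes>\<^sub>m ?e) ;; \<r> A \<oplus> \<zero> (A \<otimes> \<^bold>! A) A = (\<one> A \<otimes>\<^sub>m ?e) ;; \<r> A"
    by (rule add_zero) (rule ty)+
  finally show ?thesis .
qed

lemma chi_hom: "h \<in> hom C (D \<otimes> E) F \<Longrightarrow> chi C D E F h \<in> hom C D [F\<^sup>\<bottom> \<multimap> E\<^sup>\<bottom>]"
  using chi_bij[of D E F] by (auto simp: bij_betw_def)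

lemma transp_hom: "h \<in> hom C (D \<otimes> E) F \<Longrightarrow> transp C D E F h \<in> hom C (D \<otimes> F\<^sup>\<bottom>) (E\<^sup>\<bottom>)"
  unfolding transp_def uncur_def by (rule cmp_hom tensor_hom chi_hom ident_hom ev_hom | assumption)+

lemma transp_nat:
  assumes h: "h \<in> hom C (D \<otimes> E) F" and u: "u \<in> hom C D' D"
  shows "transp C D' E F ((u \<otimes>\<^sub>m \<one> E) ;; h) = (u \<otimes>\<^sub>m \<one> (F\<^sup>\<bottom>)) ;; transp C D E F h"
proof -
  have "(u ;; chi C D E F h) \<otimes>\<^sub>m \<one> (F\<^sup>\<bottom>) = (u \<otimes>\<^sub>m \<one> (F\<^sup>\<bottom>)) ;; (chi C D E F h \<otimes>\<^sub>m \<one> (F\<^sup>\<bottom>))"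
    by (rule tensor_cmp_l[OF u chi_hom[OF h]])
  moreover have "(u \<otimes>\<^sub>m \<one> (F\<^sup>\<bottom>)) ;; (chi C D E F h \<otimes>\<^sub>m \<one> (F\<^sup>\<bottom>)) ;; ev C (F\<^sup>\<bottom>) (E\<^sup>\<bottom>)
      = (u \<otimes>\<^sub>m \<one> (F\<^sup>\<bottom>)) ;; ((chi C D E F h \<otimes>\<^sub>m \<one> (F\<^sup>\<bottom>)) ;; ev C (F\<^sup>\<bottom>) (E\<^sup>\<bottom>))"
    by (rule cmp_assoc) (rule tensor_hom ident_hom ev_hom chi_hom h u)+
  ultimately show ?thesis
    unfolding transp_def uncur_def by (simp add: chi_nat1[OF h u])
qed

section \<open>The transposed derivative\<close>

lemma rho_hom: "f \<in> hom C (\<^bold>! A) B \<Longrightarrow> rho C A B f \<in> hom C (\<^bold>! A \<otimes> B\<^sup>\<bottom>) (A\<^sup>\<bottom>)"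
  unfolding rho_def deriv_of_def by (rule transp_hom cmp_hom symm_hom deriv_hom | assumption)+

text \<open>For the identity of the coKleisli category the transposed derivative is the transpose of an
  identity, whatever the base point.\<close>

lemma rho_der: "rho C A A (der C A) = (counit C A \<otimes>\<^sub>m \<one> (A\<^sup>\<bottom>)) ;; \<l> (A\<^sup>\<bottom>)"
proof -
  note ty = dill_typing
  have "\<s> (\<^bold>! A) A ;; deriv_of C A (der C A) = \<s> (\<^bold>! A) A ;; ((\<one> A \<otimes>\<^sub>m counit C A) ;; \<r> A)"
    by (simp only: deriv_of_def deriv_der)
  also have "\<dots> = \<s> (\<^bold>! A) A ;; (\<one> A \<otimes>\<^sub>m counit C A) ;; \<r> A"
    by (rule cmp_assoc[symmetric]) (rule ty)+
  also have "\<s> (\<^bold>! A) A ;; (\<one> A \<otimes>\<^sub>m counit C A) = (counit C A \<otimes>\<^sub>m \<one> A) ;; \<s> \<I> A"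
    by (rule symm_nat[symmetric]) (rule ty)+
  also have "(counit C A \<otimes>\<^sub>m \<one> A) ;; \<s> \<I> A ;; \<r> A = (counit C A \<otimes>\<^sub>m \<one> A) ;; (\<s> \<I> A ;; \<r> A)"
    by (rule cmp_assoc) (rule ty)+
  also have "\<s> \<I> A ;; \<r> A = \<l> A"
  proof -
    have "\<s> \<I> A ;; (\<s> A \<I> ;; \<l> A) = \<s> \<I> A ;; \<s> A \<I> ;; \<l> A"
      by (rule cmp_assoc[symmetric]) (rule ty)+
    then show ?thesis by (simp add: symm_unit symm_symm ident_cmp[OF lunit_hom])
  qed
  finally have eq: "\<s> (\<^bold>! A) A ;; deriv_of C A (der C A) = (counit C A \<otimes>\<^sub>m \<one> A) ;; \<l> A" .
  have "transp C \<I> A A (\<l> A) = \<l> (A\<^sup>\<bottom>)"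
    using chi_arr[OF ident_hom, of A] by (simp add: cmp_ident[OF lunit_hom] dual_ident)
  then show ?thesis
    unfolding rho_def eq by (simp add: transp_nat[OF lunit_hom counit_hom])
qed

text \<open>The axiom relating codereliction and \<open>p\<close> computes \<open>\<partial>\<close> of a coKleisli composite: first \<open>\<partial>f\<close>,
  then \<open>\<partial>g\<close> at the transported base point, with the base point of the composite contracted.  The
  right-hand side has the shape that compatibility of \<open>\<chi>\<close> with composition requires, in which
  directions stand to the right of base points; on the way the two copies of the base point change
  places, which cocommutativity of contraction absorbs.\<close>

lemma deriv_coKleisli_cmp:
  assumes f: "f \<in> hom C (\<^bold>! A) B" and g: "g \<in> hom C (\<^bold>! B) D"
  shows "\<s> (\<^bold>! A) A ;; deriv_of C A (dig C A ;; \<^bold>!\<^sub>m f ;; g)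
    = (contr C A \<otimes>\<^sub>m \<one> A) ;; (\<a> (\<^bold>! A) (\<^bold>! A) A ;; (\<one> (\<^bold>! A) \<otimes>\<^sub>m (\<s> (\<^bold>! A) A ;; deriv_of C A f))
      ;; (((dig C A ;; \<^bold>!\<^sub>m f) \<otimes>\<^sub>m \<one> B) ;; (\<s> (\<^bold>! B) B ;; deriv_of C B g)))"
    (is "?lhs = ?rhs")
proof -
  note ty = dill_typing f g
  let ?A = "\<^bold>! A" and ?F = "dig C A ;; \<^bold>!\<^sub>m f" and ?df = "deriv C A ;; f" and ?dg = "deriv C B ;; g"
  let ?c = "contr C A" and ?ai = "\<a>_inv A ?A ?A"
  have F: "?F \<in> hom C ?A (\<^bold>! B)" and df: "?df \<in> hom C (A \<otimes> ?A) B"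
    and dg: "?dg \<in> hom C (B \<otimes> \<^bold>! B) D"
    by (rule ty)+
  have dF: "deriv C A ;; ?F = (\<one> A \<otimes>\<^sub>m ?c) ;; (?ai ;; (?df \<otimes>\<^sub>m ?F) ;; deriv C B)"
  proof -
    have "deriv C A ;; ?F = deriv C A ;; dig C A ;; \<^bold>!\<^sub>m f"
      by (rule cmp_assoc[symmetric]) (rule ty)+
    also have "\<dots> = (\<one> A \<otimes>\<^sub>m ?c) ;; ?ai ;; (deriv C A \<otimes>\<^sub>m dig C A) ;; (deriv C ?A ;; \<^bold>!\<^sub>m f)"
      unfolding codr_chain by (rule cmp_assoc) (rule ty)+
    also have "deriv C ?A ;; \<^bold>!\<^sub>m f = (f \<otimes>\<^sub>m \<^bold>!\<^sub>m f) ;; deriv C B"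
      by (rule deriv_nat[OF f])
    also have "(\<one> A \<otimes>\<^sub>m ?c) ;; ?ai ;; (deriv C A \<otimes>\<^sub>m dig C A) ;; ((f \<otimes>\<^sub>m \<^bold>!\<^sub>m f) ;; deriv C B)
        = (\<one> A \<otimes>\<^sub>m ?c) ;; ?ai ;; ((deriv C A \<otimes>\<^sub>m dig C A) ;; ((f \<otimes>\<^sub>m \<^bold>!\<^sub>m f) ;; deriv C B))"
      by (rule cmp_assoc) (rule ty)+
    also have "(deriv C A \<otimes>\<^sub>m dig C A) ;; ((f \<otimes>\<^sub>m \<^bold>!\<^sub>m f) ;; deriv C B)
        = (deriv C A \<otimes>\<^sub>m dig C A) ;; (f \<otimes>\<^sub>m \<^bold>!\<^sub>m f) ;; deriv C B"
      by (rule cmp_assoc[symmetric]) (rule ty)+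
    also have "(deriv C A \<otimes>\<^sub>m dig C A) ;; (f \<otimes>\<^sub>m \<^bold>!\<^sub>m f) = ?df \<otimes>\<^sub>m ?F"
      by (rule tensor_cmp[symmetric]) (rule ty)+
    also have "(\<one> A \<otimes>\<^sub>m ?c) ;; ?ai ;; ((?df \<otimes>\<^sub>m ?F) ;; deriv C B)
        = (\<one> A \<otimes>\<^sub>m ?c) ;; (?ai ;; ((?df \<otimes>\<^sub>m ?F) ;; deriv C B))"
      by (rule cmp_assoc) (rule ty)+
    also have "?ai ;; ((?df \<otimes>\<^sub>m ?F) ;; deriv C B) = ?ai ;; (?df \<otimes>\<^sub>m ?F) ;; deriv C B"
      by (rule cmp_assoc[symmetric]) (rule ty)+
    finally show ?thesis .
  qed
  let ?K = "(?df \<otimes>\<^sub>m ?F) ;; ?dg"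
  have K: "?K \<in> hom C ((A \<otimes> ?A) \<otimes> ?A) D" by (rule ty)+
  have "?lhs = \<s> ?A A ;; (deriv C A ;; ?F ;; g)"
    unfolding deriv_of_def by (subst cmp_assoc[of "deriv C A"]) (rule ty refl)+
  also have "deriv C A ;; ?F ;; g = (\<one> A \<otimes>\<^sub>m ?c) ;; (?ai ;; (?df \<otimes>\<^sub>m ?F) ;; deriv C B ;; g)"
    unfolding dF by (rule cmp_assoc) (rule ty)+
  also have "?ai ;; (?df \<otimes>\<^sub>m ?F) ;; deriv C B ;; g = ?ai ;; ((?df \<otimes>\<^sub>m ?F) ;; deriv C B ;; g)"
    by (rule cmp_assoc_left) (rule ty)+
  also have "(?df \<otimes>\<^sub>m ?F) ;; deriv C B ;; g = ?K"
    by (rule cmp_assoc) (rule ty)+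
  also have "\<s> ?A A ;; ((\<one> A \<otimes>\<^sub>m ?c) ;; (?ai ;; ?K)) = \<s> ?A A ;; (\<one> A \<otimes>\<^sub>m ?c) ;; (?ai ;; ?K)"
    by (rule cmp_assoc[symmetric]) (rule ty)+
  also have "\<s> ?A A ;; (\<one> A \<otimes>\<^sub>m ?c) = (?c \<otimes>\<^sub>m \<one> A) ;; \<s> (?A \<otimes> ?A) A"
    by (rule symm_nat[symmetric]) (rule ty)+
  also have "?c \<otimes>\<^sub>m \<one> A = (?c \<otimes>\<^sub>m \<one> A) ;; (\<s> ?A ?A \<otimes>\<^sub>m \<one> A)"
    using tensor_cmp_l[OF contr_hom symm_hom, of A A] by (simp add: contr_symm)
  also have "(?c \<otimes>\<^sub>m \<one> A) ;; (\<s> ?A ?A \<otimes>\<^sub>m \<one> A) ;; \<s> (?A \<otimes> ?A) A ;; (?ai ;; ?K)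
      = (?c \<otimes>\<^sub>m \<one> A) ;; ((\<s> ?A ?A \<otimes>\<^sub>m \<one> A) ;; \<s> (?A \<otimes> ?A) A ;; (?ai ;; ?K))"
    by (rule cmp_assoc_left) (rule ty)+
  also have "(\<s> ?A ?A \<otimes>\<^sub>m \<one> A) ;; \<s> (?A \<otimes> ?A) A ;; (?ai ;; ?K)
      = (\<s> ?A ?A \<otimes>\<^sub>m \<one> A) ;; \<s> (?A \<otimes> ?A) A ;; ?ai ;; ?K"
    by (rule cmp_assoc[symmetric]) (rule ty)+
  also have "(\<s> ?A ?A \<otimes>\<^sub>m \<one> A) ;; \<s> (?A \<otimes> ?A) A ;; ?ai
      = (\<s> ?A ?A \<otimes>\<^sub>m \<one> A) ;; (\<s> (?A \<otimes> ?A) A ;; ?ai)"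
    by (rule cmp_assoc) (rule ty)+
  also have "\<dots> = \<a> ?A ?A A ;; ((\<one> ?A \<otimes>\<^sub>m \<s> ?A A) ;; \<s> ?A (A \<otimes> ?A))"
    by (rule symm_reverse)
  also have "\<dots> = \<a> ?A ?A A ;; (\<one> ?A \<otimes>\<^sub>m \<s> ?A A) ;; \<s> ?A (A \<otimes> ?A)"
    by (rule cmp_assoc[symmetric]) (rule ty)+
  also have "\<dots> ;; ?K = \<a> ?A ?A A ;; (\<one> ?A \<otimes>\<^sub>m \<s> ?A A) ;; (\<s> ?A (A \<otimes> ?A) ;; ?K)"
    by (rule cmp_assoc) (rule ty)+
  also have "\<s> ?A (A \<otimes> ?A) ;; ?K = \<s> ?A (A \<otimes> ?A) ;; (?df \<otimes>\<^sub>m ?F) ;; ?dg"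
    by (rule cmp_assoc[symmetric]) (rule ty)+
  also have "\<s> ?A (A \<otimes> ?A) ;; (?df \<otimes>\<^sub>m ?F) = (?F \<otimes>\<^sub>m ?df) ;; \<s> (\<^bold>! B) B"
    by (rule symm_nat[symmetric, OF F df])
  also have "?F \<otimes>\<^sub>m ?df = (\<one> ?A \<otimes>\<^sub>m ?df) ;; (?F \<otimes>\<^sub>m \<one> B)"
    by (rule tensor_split(2)[symmetric, OF F df])
  also have "(\<one> ?A \<otimes>\<^sub>m ?df) ;; (?F \<otimes>\<^sub>m \<one> B) ;; \<s> (\<^bold>! B) B ;; ?dg
      = (\<one> ?A \<otimes>\<^sub>m ?df) ;; ((?F \<otimes>\<^sub>m \<one> B) ;; \<s> (\<^bold>! B) B ;; ?dg)"
    by (rule cmp_assoc_left) (rule ty)+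
  also have "(?F \<otimes>\<^sub>m \<one> B) ;; \<s> (\<^bold>! B) B ;; ?dg = (?F \<otimes>\<^sub>m \<one> B) ;; (\<s> (\<^bold>! B) B ;; ?dg)"
    by (rule cmp_assoc) (rule ty)+
  also have "\<a> ?A ?A A ;; (\<one> ?A \<otimes>\<^sub>m \<s> ?A A) ;; ((\<one> ?A \<otimes>\<^sub>m ?df) ;; ((?F \<otimes>\<^sub>m \<one> B) ;; (\<s> (\<^bold>! B) B ;; ?dg)))
      = \<a> ?A ?A A ;; (\<one> ?A \<otimes>\<^sub>m \<s> ?A A) ;; (\<one> ?A \<otimes>\<^sub>m ?df) ;; ((?F \<otimes>\<^sub>m \<one> B) ;; (\<s> (\<^bold>! B) B ;; ?dg))"
    by (rule cmp_assoc[symmetric]) (rule ty)+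
  also have "\<a> ?A ?A A ;; (\<one> ?A \<otimes>\<^sub>m \<s> ?A A) ;; (\<one> ?A \<otimes>\<^sub>m ?df)
      = \<a> ?A ?A A ;; ((\<one> ?A \<otimes>\<^sub>m \<s> ?A A) ;; (\<one> ?A \<otimes>\<^sub>m ?df))"
    by (rule cmp_assoc) (rule ty)+
  also have "(\<one> ?A \<otimes>\<^sub>m \<s> ?A A) ;; (\<one> ?A \<otimes>\<^sub>m ?df) = \<one> ?A \<otimes>\<^sub>m (\<s> ?A A ;; ?df)"
    by (rule tensor_cmp_r[symmetric]) (rule ty)+
  finally show ?thesis unfolding deriv_of_def .
qed

text \<open>Transposition reverses the composition of the two derivatives.  It exchanges the two copies of
  the base point once more, again to no effect.\<close>

lemma rho_cmp:
  assumes f: "f \<in> hom C (\<^bold>! A) B" and g: "g \<in> hom C (\<^bold>! B) D"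
  shows "rho C A D (dig C A ;; \<^bold>!\<^sub>m f ;; g)
    = (contr C A \<otimes>\<^sub>m \<one> (D\<^sup>\<bottom>)) ;; (\<a> (\<^bold>! A) (\<^bold>! A) (D\<^sup>\<bottom>)
      ;; (\<one> (\<^bold>! A) \<otimes>\<^sub>m (((dig C A ;; \<^bold>!\<^sub>m f) \<otimes>\<^sub>m \<one> (D\<^sup>\<bottom>)) ;; rho C B D g)) ;; rho C A B f)"
proof -
  note ty = dill_typing f g transp_hom rho_hom
  let ?A = "\<^bold>! A" and ?F = "dig C A ;; \<^bold>!\<^sub>m f" and ?c = "contr C A"
  let ?h = "\<s> ?A A ;; deriv_of C A f" and ?k = "\<s> (\<^bold>! B) B ;; deriv_of C B g"
  have F: "?F \<in> hom C ?A (\<^bold>! B)" by (rule ty)+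
  have h: "?h \<in> hom C (?A \<otimes> A) B" and k: "?k \<in> hom C (\<^bold>! B \<otimes> B) D"
    unfolding deriv_of_def by (rule ty)+
  have k': "(?F \<otimes>\<^sub>m \<one> B) ;; ?k \<in> hom C (?A \<otimes> B) D"
    by (rule cmp_hom tensor_hom F ident_hom k)+
  let ?T = "\<a> ?A ?A (D\<^sup>\<bottom>) ;; (\<one> ?A \<otimes>\<^sub>m transp C ?A B D ((?F \<otimes>\<^sub>m \<one> B) ;; ?k)) ;; rho C A B f"
  have T_eq: "transp C ?A B D ((?F \<otimes>\<^sub>m \<one> B) ;; ?k) = (?F \<otimes>\<^sub>m \<one> (D\<^sup>\<bottom>)) ;; rho C B D g"
    unfolding rho_def by (rule transp_nat[OF k F])
  have T: "?T \<in> hom C ((?A \<otimes> ?A) \<otimes> D\<^sup>\<bottom>) (A\<^sup>\<bottom>)"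
    unfolding T_eq by (rule ty)+
  have "rho C A D (?F ;; g) = transp C ?A A D
      ((?c \<otimes>\<^sub>m \<one> A) ;; (\<a> ?A ?A A ;; (\<one> ?A \<otimes>\<^sub>m ?h) ;; ((?F \<otimes>\<^sub>m \<one> B) ;; ?k)))"
    unfolding rho_def by (simp only: deriv_coKleisli_cmp[OF f g])
  also have "\<dots> = (?c \<otimes>\<^sub>m \<one> (D\<^sup>\<bottom>)) ;; transp C (?A \<otimes> ?A) A D
      (\<a> ?A ?A A ;; (\<one> ?A \<otimes>\<^sub>m ?h) ;; ((?F \<otimes>\<^sub>m \<one> B) ;; ?k))"
    by (rule transp_nat) (rule cmp_hom tensor_hom assoc_hom ident_hom h k' contr_hom)+
  also have "transp C (?A \<otimes> ?A) A D (\<a> ?A ?A A ;; (\<one> ?A \<otimes>\<^sub>m ?h) ;; ((?F \<otimes>\<^sub>m \<one> B) ;; ?k))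
      = (\<s> ?A ?A \<otimes>\<^sub>m \<one> (D\<^sup>\<bottom>)) ;; \<a> ?A ?A (D\<^sup>\<bottom>)
        ;; (\<one> ?A \<otimes>\<^sub>m transp C ?A B D ((?F \<otimes>\<^sub>m \<one> B) ;; ?k)) ;; rho C A B f"
    unfolding rho_def by (rule chi_cmp[OF h k'])
  also have "\<dots> = (\<s> ?A ?A \<otimes>\<^sub>m \<one> (D\<^sup>\<bottom>)) ;; ?T"
    unfolding T_eq by (rule cmp_assoc_left) (rule ty)+
  also have "(?c \<otimes>\<^sub>m \<one> (D\<^sup>\<bottom>)) ;; ((\<s> ?A ?A \<otimes>\<^sub>m \<one> (D\<^sup>\<bottom>)) ;; ?T)
      = (?c \<otimes>\<^sub>m \<one> (D\<^sup>\<bottom>)) ;; (\<s> ?A ?A \<otimes>\<^sub>m \<one> (D\<^sup>\<bottom>)) ;; ?T"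
    by (rule cmp_assoc[symmetric]) (rule tensor_typing contr_hom T)+
  also have "(?c \<otimes>\<^sub>m \<one> (D\<^sup>\<bottom>)) ;; (\<s> ?A ?A \<otimes>\<^sub>m \<one> (D\<^sup>\<bottom>)) = ?c \<otimes>\<^sub>m \<one> (D\<^sup>\<bottom>)"
    using tensor_cmp_l[OF contr_hom symm_hom, of A "D\<^sup>\<bottom>"] by (simp add: contr_symm)
  finally show ?thesis unfolding T_eq .
qed

end

section \<open>The coKleisli category\<close>

context storage_cat
begin

lemma dig_bang_der_cmp:
  assumes h: "h \<in> hom C A B"
  shows "dig C A ;; \<^bold>!\<^sub>m (der C A ;; h) = \<^bold>!\<^sub>m h"
proof -
  have "dig C A ;; \<^bold>!\<^sub>m (der C A ;; h) = dig C A ;; (\<^bold>!\<^sub>m (der C A) ;; \<^bold>!\<^sub>m h)"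
    by (simp only: bang_cmp[OF der_hom h])
  also have "\<dots> = dig C A ;; \<^bold>!\<^sub>m (der C A) ;; \<^bold>!\<^sub>m h"
    by (rule cmp_assoc[symmetric]) (rule storage_typing h)+
  finally show ?thesis by (simp only: dig_bang_der ident_cmp[OF bang_hom[OF h]])
qed

lemma dig_bang_cmp_der:
  assumes h: "h \<in> hom C (\<^bold>! A) B"
  shows "dig C A ;; \<^bold>!\<^sub>m h ;; der C B = h"
proof -
  have "dig C A ;; \<^bold>!\<^sub>m h ;; der C B = dig C A ;; (\<^bold>!\<^sub>m h ;; der C B)"
    by (rule cmp_assoc) (rule storage_typing h)+
  also have "\<dots> = dig C A ;; (der C (\<^bold>! A) ;; h)"
    by (simp only: der_nat[OF h])
  also have "\<dots> = dig C A ;; der C (\<^bold>! A) ;; h"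
    by (rule cmp_assoc[symmetric]) (rule storage_typing h)+
  finally show ?thesis by (simp only: dig_der ident_cmp[OF h])
qed

lemma dig_bang_cmp_der_cmp:
  assumes h: "h \<in> hom C (\<^bold>! A) B" and k: "k \<in> hom C B D"
  shows "dig C A ;; \<^bold>!\<^sub>m h ;; (der C B ;; k) = h ;; k"
proof -
  have "dig C A ;; \<^bold>!\<^sub>m h ;; (der C B ;; k) = dig C A ;; \<^bold>!\<^sub>m h ;; der C B ;; k"
    by (rule cmp_assoc[symmetric]) (rule storage_typing h k)+
  then show ?thesis by (simp only: dig_bang_cmp_der[OF h])
qed

text \<open>Coextension \<open>h \<mapsto> p ; !h\<close> preserves composition.\<close>

lemma dig_bang_dig_cmp:
  assumes f: "f \<in> hom C (\<^bold>! A) B" and g: "g \<in> hom C (\<^bold>! B) D"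
  shows "dig C A ;; \<^bold>!\<^sub>m (dig C A ;; \<^bold>!\<^sub>m f ;; g) = dig C A ;; \<^bold>!\<^sub>m f ;; (dig C B ;; \<^bold>!\<^sub>m g)"
proof -
  note ty = storage_typing f g
  have t: "\<^bold>!\<^sub>m f \<in> hom C (\<^bold>! (\<^bold>! A)) (\<^bold>! B)" "dig C A ;; \<^bold>!\<^sub>m f \<in> hom C (\<^bold>! A) (\<^bold>! B)"
    by (rule ty)+
  have "dig C A ;; \<^bold>!\<^sub>m (dig C A ;; \<^bold>!\<^sub>m f ;; g)
      = dig C A ;; (\<^bold>!\<^sub>m (dig C A) ;; \<^bold>!\<^sub>m (\<^bold>!\<^sub>m f) ;; \<^bold>!\<^sub>m g)"
    by (simp only: bang_cmp[OF t(2) g] bang_cmp[OF dig_hom t(1)])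
  also have "\<dots> = dig C A ;; \<^bold>!\<^sub>m (dig C A) ;; \<^bold>!\<^sub>m (\<^bold>!\<^sub>m f) ;; \<^bold>!\<^sub>m g"
    by (rule cmp_assoc_left[symmetric]) (rule ty)+
  also have "\<dots> = dig C A ;; dig C (\<^bold>! A) ;; \<^bold>!\<^sub>m (\<^bold>!\<^sub>m f) ;; \<^bold>!\<^sub>m g"
    by (simp only: dig_dig)
  also have "dig C A ;; dig C (\<^bold>! A) ;; \<^bold>!\<^sub>m (\<^bold>!\<^sub>m f) = dig C A ;; (dig C (\<^bold>! A) ;; \<^bold>!\<^sub>m (\<^bold>!\<^sub>m f))"
    by (rule cmp_assoc) (rule ty)+
  also have "\<dots> = dig C A ;; (\<^bold>!\<^sub>m f ;; dig C B)"
    by (simp only: dig_nat[OF f])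
  also have "\<dots> = dig C A ;; \<^bold>!\<^sub>m f ;; dig C B"
    by (rule cmp_assoc[symmetric]) (rule ty)+
  also have "dig C A ;; \<^bold>!\<^sub>m f ;; dig C B ;; \<^bold>!\<^sub>m g = dig C A ;; \<^bold>!\<^sub>m f ;; (dig C B ;; \<^bold>!\<^sub>m g)"
    by (rule cmp_assoc) (rule ty)+
  finally show ?thesis .
qed

text \<open>The left-hand side contracts the context \<open>!X\<close>, and then the copy of \<open>!A\<close> computed from it; the
  right-hand side contracts the context twice.  They agree because \<open>!p\<close> is a morphism of comonoids
  and contraction is coassociative.\<close>

lemma contr_reassoc:
  assumes p: "p \<in> hom C X A" and q: "q \<in> hom C (\<^bold>! X) Y"
    and u: "u \<in> hom C (\<^bold>! A \<otimes> Y) Z" and v: "v \<in> hom C (\<^bold>! A \<otimes> Z) W"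
  shows "contr C X ;; (\<^bold>!\<^sub>m p \<otimes>\<^sub>m q) ;; ((contr C A \<otimes>\<^sub>m \<one> Y)
      ;; (\<a> (\<^bold>! A) (\<^bold>! A) Y ;; (\<one> (\<^bold>! A) \<otimes>\<^sub>m u) ;; v))
    = contr C X ;; (\<^bold>!\<^sub>m p \<otimes>\<^sub>m (contr C X ;; (\<^bold>!\<^sub>m p \<otimes>\<^sub>m q) ;; u)) ;; v"
proof -
  note ty = storage_typing p q u v
  let ?p = "\<^bold>!\<^sub>m p" and ?c = "contr C X" and ?A = "\<^bold>! A" and ?X = "\<^bold>! X"
  have pty: "?p \<in> hom C ?X ?A" by (rule ty)+
  have pq: "?p \<otimes>\<^sub>m q \<in> hom C (?X \<otimes> ?X) (?A \<otimes> Y)" by (rule ty)+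
  have "?c ;; (?p \<otimes>\<^sub>m q) ;; ((contr C A \<otimes>\<^sub>m \<one> Y) ;; (\<a> ?A ?A Y ;; (\<one> ?A \<otimes>\<^sub>m u) ;; v))
      = ?c ;; ((?p \<otimes>\<^sub>m q) ;; ((contr C A \<otimes>\<^sub>m \<one> Y) ;; (\<a> ?A ?A Y ;; (\<one> ?A \<otimes>\<^sub>m u) ;; v)))"
    by (rule cmp_assoc) (rule ty)+
  also have "(?p \<otimes>\<^sub>m q) ;; ((contr C A \<otimes>\<^sub>m \<one> Y) ;; (\<a> ?A ?A Y ;; (\<one> ?A \<otimes>\<^sub>m u) ;; v))
      = (?p \<otimes>\<^sub>m q) ;; (contr C A \<otimes>\<^sub>m \<one> Y) ;; (\<a> ?A ?A Y ;; (\<one> ?A \<otimes>\<^sub>m u) ;; v)"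
    by (rule cmp_assoc[symmetric]) (rule ty)+
  also have "(?p \<otimes>\<^sub>m q) ;; (contr C A \<otimes>\<^sub>m \<one> Y) = (?c \<otimes>\<^sub>m \<one> ?X) ;; ((?p \<otimes>\<^sub>m ?p) \<otimes>\<^sub>m q)"
    using tensor_cmp[OF pty contr_hom q ident_hom]
      tensor_cmp[OF contr_hom tensor_hom[OF pty pty] ident_hom q]
    by (simp add: contr_nat[OF p] ident_cmp[OF q] cmp_ident[OF q])
  also have "\<dots> ;; (\<a> ?A ?A Y ;; (\<one> ?A \<otimes>\<^sub>m u) ;; v)
      = (?c \<otimes>\<^sub>m \<one> ?X) ;; (((?p \<otimes>\<^sub>m ?p) \<otimes>\<^sub>m q) ;; (\<a> ?A ?A Y ;; (\<one> ?A \<otimes>\<^sub>m u) ;; v))"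
    by (rule cmp_assoc) (rule ty)+
  also have "((?p \<otimes>\<^sub>m ?p) \<otimes>\<^sub>m q) ;; (\<a> ?A ?A Y ;; (\<one> ?A \<otimes>\<^sub>m u) ;; v)
      = ((?p \<otimes>\<^sub>m ?p) \<otimes>\<^sub>m q) ;; \<a> ?A ?A Y ;; (\<one> ?A \<otimes>\<^sub>m u) ;; v"
    by (rule cmp_assoc_left[symmetric]) (rule ty)+
  also have "((?p \<otimes>\<^sub>m ?p) \<otimes>\<^sub>m q) ;; \<a> ?A ?A Y = \<a> ?X ?X ?X ;; (?p \<otimes>\<^sub>m (?p \<otimes>\<^sub>m q))"
    by (rule assoc_nat[OF pty pty q])
  also have "\<a> ?X ?X ?X ;; (?p \<otimes>\<^sub>m (?p \<otimes>\<^sub>m q)) ;; (\<one> ?A \<otimes>\<^sub>m u)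
      = \<a> ?X ?X ?X ;; ((?p \<otimes>\<^sub>m (?p \<otimes>\<^sub>m q)) ;; (\<one> ?A \<otimes>\<^sub>m u))"
    by (rule cmp_assoc) (rule ty)+
  also have "(?p \<otimes>\<^sub>m (?p \<otimes>\<^sub>m q)) ;; (\<one> ?A \<otimes>\<^sub>m u) = ?p \<otimes>\<^sub>m ((?p \<otimes>\<^sub>m q) ;; u)"
    using tensor_cmp[OF pty ident_hom pq u] by (simp add: cmp_ident[OF pty])
  also have "(?c \<otimes>\<^sub>m \<one> ?X) ;; (\<a> ?X ?X ?X ;; (?p \<otimes>\<^sub>m ((?p \<otimes>\<^sub>m q) ;; u)) ;; v)
      = (?c \<otimes>\<^sub>m \<one> ?X) ;; \<a> ?X ?X ?X ;; (?p \<otimes>\<^sub>m ((?p \<otimes>\<^sub>m q) ;; u)) ;; v"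
    by (rule cmp_assoc_left[symmetric]) (rule ty)+
  also have "\<dots> = (?c \<otimes>\<^sub>m \<one> ?X) ;; \<a> ?X ?X ?X ;; ((?p \<otimes>\<^sub>m ((?p \<otimes>\<^sub>m q) ;; u)) ;; v)"
    by (rule cmp_assoc) (rule ty)+
  also have "?c ;; ((?c \<otimes>\<^sub>m \<one> ?X) ;; \<a> ?X ?X ?X ;; ((?p \<otimes>\<^sub>m ((?p \<otimes>\<^sub>m q) ;; u)) ;; v))
      = ?c ;; (?c \<otimes>\<^sub>m \<one> ?X) ;; \<a> ?X ?X ?X ;; ((?p \<otimes>\<^sub>m ((?p \<otimes>\<^sub>m q) ;; u)) ;; v)"
    by (rule cmp_assoc_left[symmetric]) (rule ty)+
  also have "\<dots> = ?c ;; (\<one> ?X \<otimes>\<^sub>m ?c) ;; ((?p \<otimes>\<^sub>m ((?p \<otimes>\<^sub>m q) ;; u)) ;; v)"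
    by (simp only: contr_assoc)
  also have "\<dots> = ?c ;; ((\<one> ?X \<otimes>\<^sub>m ?c) ;; ((?p \<otimes>\<^sub>m ((?p \<otimes>\<^sub>m q) ;; u)) ;; v))"
    by (rule cmp_assoc) (rule ty)+
  also have "(\<one> ?X \<otimes>\<^sub>m ?c) ;; ((?p \<otimes>\<^sub>m ((?p \<otimes>\<^sub>m q) ;; u)) ;; v)
      = (\<one> ?X \<otimes>\<^sub>m ?c) ;; (?p \<otimes>\<^sub>m ((?p \<otimes>\<^sub>m q) ;; u)) ;; v"
    by (rule cmp_assoc[symmetric]) (rule ty)+
  also have "(\<one> ?X \<otimes>\<^sub>m ?c) ;; (?p \<otimes>\<^sub>m ((?p \<otimes>\<^sub>m q) ;; u)) = ?p \<otimes>\<^sub>m (?c ;; ((?p \<otimes>\<^sub>m q) ;; u))"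
    using tensor_cmp[OF ident_hom pty contr_hom cmp_hom[OF pq u]] by (simp add: ident_cmp[OF pty])
  also have "?c ;; ((?p \<otimes>\<^sub>m q) ;; u) = ?c ;; (?p \<otimes>\<^sub>m q) ;; u"
    by (rule cmp_assoc[symmetric]) (rule ty)+
  also have "?c ;; ((?p \<otimes>\<^sub>m (?c ;; (?p \<otimes>\<^sub>m q) ;; u)) ;; v) = ?c ;; (?p \<otimes>\<^sub>m (?c ;; (?p \<otimes>\<^sub>m q) ;; u)) ;; v"
    by (rule cmp_assoc[symmetric]) (rule ty)+
  finally show ?thesis .
qed

text \<open>Digging distributes over the contraction into which the inverse Seely map splits the pairing;
  dereliction then cancels the copy of \<open>p\<close> in front of \<open>v\<close>, so that \<open>v\<close> enters linearly.\<close>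

lemma coKleisli_tup_seely_inv:
  assumes u: "u \<in> hom C (\<^bold>! X) A" and v: "v \<in> hom C (\<^bold>! X) B" and r: "r \<in> hom C (\<^bold>! A \<otimes> B) E"
  shows "dig C X ;; \<^bold>!\<^sub>m \<langle>u, v\<rangle> ;; (seely_inv C A B ;; (\<one> (\<^bold>! A) \<otimes>\<^sub>m der C B) ;; r)
    = contr C X ;; ((dig C X ;; \<^bold>!\<^sub>m u) \<otimes>\<^sub>m v) ;; r"
proof -
  note ty = storage_typing u v r
  let ?d = "dig C X" and ?t = "\<^bold>!\<^sub>m \<langle>u, v\<rangle>" and ?e = "\<one> (\<^bold>! A) \<otimes>\<^sub>m der C B"
  have du: "?d ;; \<^bold>!\<^sub>m u \<in> hom C (\<^bold>! X) (\<^bold>! A)" and dv: "?d ;; \<^bold>!\<^sub>m v \<in> hom C (\<^bold>! X) (\<^bold>! B)"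
    by (rule ty)+
  have "?d ;; ?t ;; (seely_inv C A B ;; ?e ;; r) = ?d ;; ?t ;; seely_inv C A B ;; ?e ;; r"
    by (rule cmp_assoc_left[symmetric]) (rule ty)+
  also have "?d ;; ?t ;; seely_inv C A B = ?d ;; (?t ;; seely_inv C A B)"
    by (rule cmp_assoc) (rule ty)+
  also have "?t ;; seely_inv C A B = contr C (\<^bold>! X) ;; (\<^bold>!\<^sub>m u \<otimes>\<^sub>m \<^bold>!\<^sub>m v)"
    by (rule bang_tup_seely_inv[OF u v])
  also have "?d ;; \<dots> = ?d ;; contr C (\<^bold>! X) ;; (\<^bold>!\<^sub>m u \<otimes>\<^sub>m \<^bold>!\<^sub>m v)"
    by (rule cmp_assoc[symmetric]) (rule ty)+
  also have "\<dots> = contr C X ;; (?d \<otimes>\<^sub>m ?d) ;; (\<^bold>!\<^sub>m u \<otimes>\<^sub>m \<^bold>!\<^sub>m v)"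
    by (simp only: dig_contr)
  also have "\<dots> = contr C X ;; ((?d \<otimes>\<^sub>m ?d) ;; (\<^bold>!\<^sub>m u \<otimes>\<^sub>m \<^bold>!\<^sub>m v))"
    by (rule cmp_assoc) (rule ty)+
  also have "(?d \<otimes>\<^sub>m ?d) ;; (\<^bold>!\<^sub>m u \<otimes>\<^sub>m \<^bold>!\<^sub>m v) = (?d ;; \<^bold>!\<^sub>m u) \<otimes>\<^sub>m (?d ;; \<^bold>!\<^sub>m v)"
    by (rule tensor_cmp[symmetric]) (rule ty)+
  also have "contr C X ;; \<dots> ;; ?e = contr C X ;; (((?d ;; \<^bold>!\<^sub>m u) \<otimes>\<^sub>m (?d ;; \<^bold>!\<^sub>m v)) ;; ?e)"
    by (rule cmp_assoc) (rule ty)+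
  also have "((?d ;; \<^bold>!\<^sub>m u) \<otimes>\<^sub>m (?d ;; \<^bold>!\<^sub>m v)) ;; ?e = (?d ;; \<^bold>!\<^sub>m u) \<otimes>\<^sub>m v"
    using tensor_cmp[OF du ident_hom dv der_hom] by (simp add: cmp_ident[OF du] dig_bang_cmp_der[OF v])
  finally show ?thesis .
qed

end

context classical_dill
begin

abbreviation "K \<equiv> coKleisli C"

lemma coKleisli_hom_iff:
  "u \<in> hom K A B \<longleftrightarrow> (\<exists>f. u = Arrow A f B \<and> f \<in> hom C (\<^bold>! A) B)"
  by (auto simp: coKleisli_def)

lemma coKleisli_simps:
  "Arrow A f B ;;\<^bsub>K\<^esub> Arrow B' g D = Arrow A (dig C A ;; \<^bold>!\<^sub>m f ;; g) D"
  "\<one>\<^bsub>K\<^esub> A = Arrow A (der C A) A"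
  "prd K = prd C"
  "pr1 K A B = Arrow (A && B) (der C (A && B) ;; pr1 C A B) A"
  "pr2 K A B = Arrow (A && B) (der C (A && B) ;; pr2 C A B) B"
  "\<langle>Arrow X f A, Arrow X' g B\<rangle>\<^bsub>K\<^esub> = Arrow X \<langle>f, g\<rangle> (A && B)"
  by (simp_all add: coKleisli_def)

lemma cartesian_coKleisli: "cartesian K"
proof
  note ty = storage_typing
  fix A B D E X
  show "\<one>\<^bsub>K\<^esub> A \<in> hom K A A"
    by (simp add: coKleisli_hom_iff coKleisli_simps der_hom)
  show "pr1 K A B \<in> hom K (A &&\<^bsub>K\<^esub> B) A" "pr2 K A B \<in> hom K (A &&\<^bsub>K\<^esub> B) B"
    by (simp_all add: coKleisli_hom_iff coKleisli_simps cmp_hom[OF der_hom pr1_hom]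
      cmp_hom[OF der_hom pr2_hom])
  {
    fix u v assume "u \<in> hom K A B" "v \<in> hom K B D"
    then obtain f g where u: "u = Arrow A f B" and v: "v = Arrow B g D"
      and f: "f \<in> hom C (\<^bold>! A) B" and g: "g \<in> hom C (\<^bold>! B) D"
      unfolding coKleisli_hom_iff by blast
    have "dig C A ;; \<^bold>!\<^sub>m f ;; g \<in> hom C (\<^bold>! A) D" by (rule ty f g)+
    then show "u ;;\<^bsub>K\<^esub> v \<in> hom K A D"
      by (simp add: u v coKleisli_hom_iff coKleisli_simps)
  }
  {
    fix u v w assume "u \<in> hom K A B" "v \<in> hom K B D" "w \<in> hom K D E"
    then obtain f g h where u: "u = Arrow A f B" and v: "v = Arrow B g D" and w: "w = Arrow D h E"
      and f: "f \<in> hom C (\<^bold>! A) B" and g: "g \<in> hom C (\<^bold>! B) D" and h: "h \<in> hom C (\<^bold>! D) E"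
      unfolding coKleisli_hom_iff by blast
    have "dig C A ;; \<^bold>!\<^sub>m f ;; (dig C B ;; \<^bold>!\<^sub>m g) ;; h = dig C A ;; \<^bold>!\<^sub>m f ;; (dig C B ;; \<^bold>!\<^sub>m g ;; h)"
      by (rule cmp_assoc) (rule ty f g h)+
    then show "u ;;\<^bsub>K\<^esub> v ;;\<^bsub>K\<^esub> w = u ;;\<^bsub>K\<^esub> (v ;;\<^bsub>K\<^esub> w)"
      by (simp add: u v w coKleisli_simps dig_bang_dig_cmp[OF f g])
  }
  {
    fix u assume "u \<in> hom K A B"
    then obtain f where u: "u = Arrow A f B" and f: "f \<in> hom C (\<^bold>! A) B"
      unfolding coKleisli_hom_iff by blast
    show "\<one>\<^bsub>K\<^esub> A ;;\<^bsub>K\<^esub> u = u" "u ;;\<^bsub>K\<^esub> \<one>\<^bsub>K\<^esub> B = u"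
      by (simp_all add: u coKleisli_simps dig_bang_der ident_cmp[OF f] dig_bang_cmp_der[OF f])
  }
  {
    fix u v assume "u \<in> hom K X A" "v \<in> hom K X B"
    then obtain f g where u: "u = Arrow X f A" and v: "v = Arrow X g B"
      and f: "f \<in> hom C (\<^bold>! X) A" and g: "g \<in> hom C (\<^bold>! X) B"
      unfolding coKleisli_hom_iff by blast
    show "\<langle>u, v\<rangle>\<^bsub>K\<^esub> \<in> hom K X (A &&\<^bsub>K\<^esub> B)"
      by (simp add: u v coKleisli_hom_iff coKleisli_simps tup_hom[OF f g])
    show "\<langle>u, v\<rangle>\<^bsub>K\<^esub> ;;\<^bsub>K\<^esub> pr1 K A B = u" "\<langle>u, v\<rangle>\<^bsub>K\<^esub> ;;\<^bsub>K\<^esub> pr2 K A B = v"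
      by (simp_all add: u v coKleisli_simps
        dig_bang_cmp_der_cmp[OF tup_hom[OF f g] pr1_hom]
        dig_bang_cmp_der_cmp[OF tup_hom[OF f g] pr2_hom] tup_pr1[OF f g] tup_pr2[OF f g])
  }
  {
    fix u assume "u \<in> hom K X (A &&\<^bsub>K\<^esub> B)"
    then obtain h where u: "u = Arrow X h (A && B)" and h: "h \<in> hom C (\<^bold>! X) (A && B)"
      unfolding coKleisli_hom_iff coKleisli_simps by blast
    show "\<langle>u ;;\<^bsub>K\<^esub> pr1 K A B, u ;;\<^bsub>K\<^esub> pr2 K A B\<rangle>\<^bsub>K\<^esub> = u"
      by (simp add: u coKleisli_simps dig_bang_cmp_der_cmp[OF h pr1_hom]
        dig_bang_cmp_der_cmp[OF h pr2_hom] tup_unique[OF h])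
  }
qed

section \<open>The reverse differential and its chain rule\<close>

lemma rev_diff_Arrow:
  "rev_diff C (Arrow A f B) = Arrow (A && B\<^sup>\<bottom>)
     (seely_inv C A (B\<^sup>\<bottom>) ;; (\<one> (\<^bold>! A) \<otimes>\<^sub>m der C (B\<^sup>\<bottom>)) ;; rho C A B f) (A\<^sup>\<bottom>)"
  by (simp add: rev_diff_def)

lemma rev_diff_hom: "u \<in> hom K A B \<Longrightarrow> rev_diff C u \<in> hom K (A &&\<^bsub>K\<^esub> B\<^sup>\<bottom>) (A\<^sup>\<bottom>)"
proof -
  assume "u \<in> hom K A B"
  then obtain f where u: "u = Arrow A f B" and f: "f \<in> hom C (\<^bold>! A) B"
    unfolding coKleisli_hom_iff by blast
  have "seely_inv C A (B\<^sup>\<bottom>) ;; (\<one> (\<^bold>! A) \<otimes>\<^sub>m der C (B\<^sup>\<bottom>)) ;; rho C A B f \<in> hom C (\<^bold>! (A && B\<^sup>\<bottom>)) (A\<^sup>\<bottom>)"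
    by (rule storage_typing rho_hom f)+
  then show ?thesis by (simp add: u rev_diff_Arrow coKleisli_hom_iff coKleisli_simps)
qed

lemma seely_inv_tensor:
  assumes "h \<in> hom C (\<^bold>! B) D"
  shows "seely_inv C A B ;; (\<one> (\<^bold>! A) \<otimes>\<^sub>m h)
    = contr C (A && B) ;; (\<^bold>!\<^sub>m (pr1 C A B) \<otimes>\<^sub>m (\<^bold>!\<^sub>m (pr2 C A B) ;; h))"
proof -
  note ty = storage_typing assms
  have p: "\<^bold>!\<^sub>m (pr1 C A B) \<in> hom C (\<^bold>! (A && B)) (\<^bold>! A)"
    and q: "\<^bold>!\<^sub>m (pr2 C A B) \<in> hom C (\<^bold>! (A && B)) (\<^bold>! B)" by (rule ty)+
  have "seely_inv C A B ;; (\<one> (\<^bold>! A) \<otimes>\<^sub>m h) = contr C (A && B)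
      ;; ((\<^bold>!\<^sub>m (pr1 C A B) \<otimes>\<^sub>m \<^bold>!\<^sub>m (pr2 C A B)) ;; (\<one> (\<^bold>! A) \<otimes>\<^sub>m h))"
    unfolding seely_inv_def by (rule cmp_assoc) (rule ty)+
  then show ?thesis
    using tensor_cmp[OF p ident_hom q assms] by (simp add: cmp_ident[OF p])
qed

text \<open>As \<open>rho\<close> of the identity discards the base point, what remains of the Seely map is the second
  projection.\<close>

lemma rev_diff_ident: "rev_diff C (\<one>\<^bsub>K\<^esub> A) = pr2 K A (A\<^sup>\<bottom>)"
proof -
  note ty = storage_typing
  let ?Y = "A\<^sup>\<bottom>" and ?e = "counit C A"
  let ?d = "der C ?Y"
  have "seely_inv C A ?Y ;; (\<one> (\<^bold>! A) \<otimes>\<^sub>m ?d) ;; rho C A A (der C A)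
      = seely_inv C A ?Y ;; (\<one> (\<^bold>! A) \<otimes>\<^sub>m ?d) ;; (?e \<otimes>\<^sub>m \<one> ?Y) ;; \<l> ?Y"
    unfolding rho_der by (rule cmp_assoc[symmetric]) (rule ty)+
  also have "\<dots> = seely_inv C A ?Y ;; ((\<one> (\<^bold>! A) \<otimes>\<^sub>m ?d) ;; (?e \<otimes>\<^sub>m \<one> ?Y) ;; \<l> ?Y)"
    by (rule cmp_assoc_left) (rule ty)+
  also have "(\<one> (\<^bold>! A) \<otimes>\<^sub>m ?d) ;; (?e \<otimes>\<^sub>m \<one> ?Y) = (?e \<otimes>\<^sub>m \<one> (\<^bold>! ?Y)) ;; (\<one> \<I> \<otimes>\<^sub>m ?d)"
    using tensor_split[OF counit_hom der_hom, of A ?Y] by simp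
  also have "(?e \<otimes>\<^sub>m \<one> (\<^bold>! ?Y)) ;; (\<one> \<I> \<otimes>\<^sub>m ?d) ;; \<l> ?Y = (?e \<otimes>\<^sub>m \<one> (\<^bold>! ?Y)) ;; ((\<one> \<I> \<otimes>\<^sub>m ?d) ;; \<l> ?Y)"
    by (rule cmp_assoc) (rule ty)+
  also have "(\<one> \<I> \<otimes>\<^sub>m ?d) ;; \<l> ?Y = \<l> (\<^bold>! ?Y) ;; ?d"
    by (rule lunit_nat) (rule ty)
  also have "(?e \<otimes>\<^sub>m \<one> (\<^bold>! ?Y)) ;; (\<l> (\<^bold>! ?Y) ;; ?d) = (?e \<otimes>\<^sub>m \<one> (\<^bold>! ?Y)) ;; \<l> (\<^bold>! ?Y) ;; ?d"
    by (rule cmp_assoc[symmetric]) (rule ty)+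
  also have "seely_inv C A ?Y ;; \<dots> = seely_inv C A ?Y ;; ((?e \<otimes>\<^sub>m \<one> (\<^bold>! ?Y)) ;; \<l> (\<^bold>! ?Y)) ;; ?d"
    by (rule cmp_assoc[symmetric]) (rule ty)+
  also have "\<dots> = der C (A && ?Y) ;; pr2 C A ?Y"
    by (simp only: seely_pr2[symmetric] der_nat[OF pr2_hom])
  finally show ?thesis by (simp add: coKleisli_simps rev_diff_Arrow)
qed

text \<open>On the left \<open>rho_cmp\<close> contracts the base point; on the right each of the two pairings contracts
  the context \<open>!(A & D\<^sup>\<bottom>)\<close>.  Apart from that the two sides apply the same \<open>\<rho>g\<close> and \<open>\<rho>f\<close>, so
  \<open>contr_reassoc\<close> identifies them.\<close>

theorem rev_diff_cmp:
  assumes "u \<in> hom K A B" "v \<in> hom K B D"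
  shows "rev_diff C (u ;;\<^bsub>K\<^esub> v)
    = \<langle>pr1 K A (D\<^sup>\<bottom>), times_id K A (D\<^sup>\<bottom>) u ;;\<^bsub>K\<^esub> rev_diff C v\<rangle>\<^bsub>K\<^esub> ;;\<^bsub>K\<^esub> rev_diff C u"
proof -
  obtain f g where u: "u = Arrow A f B" and v: "v = Arrow B g D"
    and f: "f \<in> hom C (\<^bold>! A) B" and g: "g \<in> hom C (\<^bold>! B) D"
    using assms unfolding coKleisli_hom_iff by blast
  note ty = storage_typing f g rho_hom
  let ?Y = "D\<^sup>\<bottom>"
  let ?X = "A && ?Y" and ?F = "dig C A ;; \<^bold>!\<^sub>m f" and ?p = "pr1 C A ?Y"
    and ?rf = "rho C A B f" and ?rg = "rho C B D g"
  let ?c = "contr C ?X" and ?q = "\<^bold>!\<^sub>m (pr2 C A ?Y) ;; der C ?Y"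
  let ?t = "\<langle>dig C ?X ;; \<^bold>!\<^sub>m (der C ?X ;; ?p) ;; f, der C ?X ;; pr2 C A ?Y\<rangle>"
  \<comment> \<open>\<open>?t\<close> is the coKleisli arrow \<open>f \<times> 1\<close> and \<open>?m\<close> its composite with \<open>Rg\<close>, both out of \<open>A \<times> D\<^sup>\<bottom>\<close>\<close>
  let ?m = "dig C ?X ;; \<^bold>!\<^sub>m ?t ;; (seely_inv C B ?Y ;; (\<one> (\<^bold>! B) \<otimes>\<^sub>m der C ?Y) ;; ?rg)"
  have q: "?q \<in> hom C (\<^bold>! ?X) ?Y" and F: "?F \<in> hom C (\<^bold>! A) (\<^bold>! B)"
    and pty: "\<^bold>!\<^sub>m ?p \<in> hom C (\<^bold>! ?X) (\<^bold>! A)"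
    and m: "?m \<in> hom C (\<^bold>! ?X) (B\<^sup>\<bottom>)" and dp: "der C ?X ;; ?p \<in> hom C (\<^bold>! ?X) A"
    and pf: "dig C ?X ;; \<^bold>!\<^sub>m (der C ?X ;; ?p) ;; f \<in> hom C (\<^bold>! ?X) B"
    by (rule ty)+
  have m_eq: "?m = ?c ;; (\<^bold>!\<^sub>m ?p \<otimes>\<^sub>m ?q) ;; ((?F \<otimes>\<^sub>m \<one> ?Y) ;; ?rg)"
  proof -
    have "?m = ?c ;; ((dig C ?X ;; \<^bold>!\<^sub>m (dig C ?X ;; \<^bold>!\<^sub>m (der C ?X ;; ?p) ;; f))
        \<otimes>\<^sub>m (der C ?X ;; pr2 C A ?Y)) ;; ?rg"
      by (rule coKleisli_tup_seely_inv) (rule ty)+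
    also have "dig C ?X ;; \<^bold>!\<^sub>m (dig C ?X ;; \<^bold>!\<^sub>m (der C ?X ;; ?p) ;; f) = \<^bold>!\<^sub>m ?p ;; ?F"
      unfolding dig_bang_dig_cmp[OF dp f] unfolding dig_bang_der_cmp[OF pr1_hom] by (rule refl)
    also have "der C ?X ;; pr2 C A ?Y = ?q"
      by (rule der_nat[symmetric]) (rule ty)
    also have "(\<^bold>!\<^sub>m ?p ;; ?F) \<otimes>\<^sub>m ?q = (\<^bold>!\<^sub>m ?p \<otimes>\<^sub>m ?q) ;; (?F \<otimes>\<^sub>m \<one> ?Y)"
      using tensor_cmp[OF pty F q ident_hom] by (simp only: cmp_ident[OF q])
    also have "?c ;; \<dots> ;; ?rg = ?c ;; ((\<^bold>!\<^sub>m ?p \<otimes>\<^sub>m ?q) ;; (?F \<otimes>\<^sub>m \<one> ?Y) ;; ?rg)"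
      by (rule cmp_assoc) (rule ty)+
    also have "\<dots> = ?c ;; (\<^bold>!\<^sub>m ?p \<otimes>\<^sub>m ?q) ;; (?F \<otimes>\<^sub>m \<one> ?Y) ;; ?rg"
      by (rule cmp_assoc_left[symmetric]) (rule ty)+
    also have "\<dots> = ?c ;; (\<^bold>!\<^sub>m ?p \<otimes>\<^sub>m ?q) ;; ((?F \<otimes>\<^sub>m \<one> ?Y) ;; ?rg)"
      by (rule cmp_assoc) (rule ty)+
    finally show ?thesis by (simp only: der_nat[OF pr2_hom])
  qed
  have "seely_inv C A ?Y ;; (\<one> (\<^bold>! A) \<otimes>\<^sub>m der C ?Y) ;; rho C A D (?F ;; g)
      = ?c ;; (\<^bold>!\<^sub>m ?p \<otimes>\<^sub>m ?q) ;; ((contr C A \<otimes>\<^sub>m \<one> ?Y) ;; (\<a> (\<^bold>! A) (\<^bold>! A) ?Y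
        ;; (\<one> (\<^bold>! A) \<otimes>\<^sub>m ((?F \<otimes>\<^sub>m \<one> ?Y) ;; ?rg)) ;; ?rf))"
    by (simp only: seely_inv_tensor[OF der_hom] rho_cmp[OF f g])
  also have "\<dots> = ?c ;; (\<^bold>!\<^sub>m ?p \<otimes>\<^sub>m (?c ;; (\<^bold>!\<^sub>m ?p \<otimes>\<^sub>m ?q) ;; ((?F \<otimes>\<^sub>m \<one> ?Y) ;; ?rg))) ;; ?rf"
    by (rule contr_reassoc) (rule ty)+
  also have "\<dots> = ?c ;; ((dig C ?X ;; \<^bold>!\<^sub>m (der C ?X ;; ?p)) \<otimes>\<^sub>m ?m) ;; ?rf"
    unfolding m_eq unfolding dig_bang_der_cmp[OF pr1_hom] by (rule refl)
  also have "\<dots> = dig C ?X ;; \<^bold>!\<^sub>m \<langle>der C ?X ;; ?p, ?m\<rangle>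
      ;; (seely_inv C A (B\<^sup>\<bottom>) ;; (\<one> (\<^bold>! A) \<otimes>\<^sub>m der C (B\<^sup>\<bottom>)) ;; ?rf)"
    by (rule coKleisli_tup_seely_inv[OF dp m rho_hom[OF f], symmetric])
  finally show ?thesis
    by (simp add: u v coKleisli_simps rev_diff_Arrow cartesian.times_id_eq[OF cartesian_coKleisli])
qed

end

section \<open>The functor to Euclidean lenses\<close>

theorem proposition3p5:
  fixes C :: "('o, 'm, 'z) dill_scheme"
  assumes "classical_dill C"
  shows "\<exists>Do Da.
    functor_between (coKleisli C) (ELens (coKleisli C)) Do Da \<and>
    (\<forall>A. Do A = (A, dual C A)) \<and>
    (\<forall>A B. \<forall>f \<in> hom (coKleisli C) A B.
       Da f = Arrow (A, dual C A)
                (Lens f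
                   (tup (coKleisli C) (pr1 (coKleisli C) A (dual C B)) (rev_diff C f))
                   (times_id (coKleisli C) A (dual C B) f))
                (B, dual C B))"
proof -
  interpret classical_dill C by fact
  interpret K: cartesian K by (rule cartesian_coKleisli)
  define Do where "Do = (\<lambda>A. (A, dual C A))"
  define leg where "leg f = \<langle>pr1 K (source f) (dual C (target f)), rev_diff C f\<rangle>\<^bsub>K\<^esub>" for f
  define Da where "Da = (\<lambda>f. Arrow (Do (source f))
    (Lens f (leg f) (times_id K (source f) (dual C (target f)) f)) (Do (target f)))"
  have source_target: "source f = A" "target f = B" if "f \<in> hom K A B" for f A B
    using that by (auto simp: coKleisli_hom_iff)
  have leg_eq: "leg f = \<langle>pr1 K A (dual C B), rev_diff C f\<rangle>\<^bsub>K\<^esub>" if "f \<in> hom K A B" for f A B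
    using that by (simp add: leg_def source_target)
  have leg_hom: "leg f \<in> hom K (prd K A (dual C B)) (prd K A (dual C A))"
    and leg_pr1: "leg f ;;\<^bsub>K\<^esub> pr1 K A (dual C A) = pr1 K A (dual C B)"
    and leg_pr2: "leg f ;;\<^bsub>K\<^esub> pr2 K A (dual C A) = rev_diff C f" if f: "f \<in> hom K A B" for f A B
    unfolding leg_eq[OF f]
    by (rule K.tup_hom K.tup_pr1 K.tup_pr2 K.pr1_hom rev_diff_hom f)+
  have Da_eq: "Da f = Arrow (A, dual C A)
      (Lens f (leg f) (times_id K A (dual C B) f)) (B, dual C B)" if "f \<in> hom K A B" for f A B
    using that by (simp add: Da_def Do_def source_target)
  have "functor_between K (ELens K) Do Da"
  proof (intro functor_between.intro functor_between_axioms.intro K.category_axioms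
      K.category_ELens)
    fix f A B assume f: "f \<in> hom K A B"
    show "Da f \<in> hom (ELens K) (Do A) (Do B)"
      using f leg_hom[OF f] leg_pr1[OF f] by (simp add: Do_def Da_eq[OF f] K.ELens_hom_iff)
  next
    fix A
    have "leg (\<one>\<^bsub>K\<^esub> A) = \<one>\<^bsub>K\<^esub> (prd K A (dual C A))"
      by (simp add: leg_eq[OF K.ident_hom] rev_diff_ident K.tup_pr1_pr2)
    then show "Da (\<one>\<^bsub>K\<^esub> A) = \<one>\<^bsub>ELens K\<^esub> (Do A)"
      by (simp add: Do_def Da_eq[OF K.ident_hom] K.ELens_ident K.times_id_ident)
  next
    fix f g A B D assume f: "f \<in> hom K A B" and g: "g \<in> hom K B D"
    note ty = K.cmp_hom K.tup_hom K.pr1_hom K.pr2_hom K.times_id_hom leg_hom rev_diff_hom f g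
    let ?Y = "dual C D"
    let ?P = "K.pull A B (dual C B) ?Y f (leg g)"
    have P: "?P = \<langle>pr1 K A ?Y, times_id K A ?Y f ;;\<^bsub>K\<^esub> rev_diff C g\<rangle>\<^bsub>K\<^esub>"
    proof -
      have "times_id K A ?Y f ;;\<^bsub>K\<^esub> leg g ;;\<^bsub>K\<^esub> pr2 K B (dual C B)
          = times_id K A ?Y f ;;\<^bsub>K\<^esub> (leg g ;;\<^bsub>K\<^esub> pr2 K B (dual C B))"
        by (rule K.cmp_assoc) (rule ty)+
      then show ?thesis by (simp add: K.pull_def leg_pr2[OF g])
    qed
    have Pty: "?P \<in> hom K (prd K A ?Y) (prd K A (dual C B))"
      by (rule K.pull_hom ty)+
    have "?P ;;\<^bsub>K\<^esub> leg f = \<langle>?P ;;\<^bsub>K\<^esub> pr1 K A (dual C B), ?P ;;\<^bsub>K\<^esub> rev_diff C f\<rangle>\<^bsub>K\<^esub>"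
      unfolding leg_eq[OF f] by (rule K.tup_cmp[OF Pty]) (rule ty)+
    also have "?P ;;\<^bsub>K\<^esub> pr1 K A (dual C B) = pr1 K A ?Y"
      by (rule K.pull_pr1) (rule ty)+
    also have "?P ;;\<^bsub>K\<^esub> rev_diff C f = rev_diff C (f ;;\<^bsub>K\<^esub> g)"
      unfolding P by (rule rev_diff_cmp[OF f g, symmetric])
    also have "\<langle>pr1 K A ?Y, \<dots>\<rangle>\<^bsub>K\<^esub> = leg (f ;;\<^bsub>K\<^esub> g)"
      by (rule leg_eq[OF K.cmp_hom[OF f g], symmetric])
    finally show "Da (f ;;\<^bsub>K\<^esub> g) = Da f ;;\<^bsub>ELens K\<^esub> Da g"
      by (simp add: Da_eq[OF f] Da_eq[OF g] Da_eq[OF K.cmp_hom[OF f g]] K.ELens_cmp)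
  qed
  moreover have "\<forall>A. Do A = (A, dual C A)"
    by (simp add: Do_def)
  moreover have "\<forall>A B. \<forall>f \<in> hom K A B. Da f = Arrow (A, dual C A)
      (Lens f \<langle>pr1 K A (dual C B), rev_diff C f\<rangle>\<^bsub>K\<^esub> (times_id K A (dual C B) f)) (B, dual C B)"
    by (simp add: Da_eq leg_eq)
  ultimately show ?thesis by blast
qed

end
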